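(* Let $G$ be a Lie group with Lie algebra $\mathfrak{g}$, let $\pi:P\to M$ be a smooth principal $G$-bundle over a smooth manifold $M$, and let $X\in\Gamma(P\times_G\mathfrak{g})$ be a smooth section of the adjoint bundle. Then the parametrized gauge quandle $(P,\triangleleft^{X}_{t})$, i.e. $P$ with the operation $P\times\mathbb{R}\times P\to P$ given by $$p_{1}\triangleleft^{X}_{t} p_{2}:=p_{1}\cdot \bigl(\exp(-tX(p_{1}))\exp(tX(p_{2}))\bigr),\qquad p_1,p_2\in P,\ t\in\mathbb{R},$$ is a Lie quandle. Moreover, it is a Noether quandle.
   Context: $G$ acts on $P$ on the right. Sections $X\in\Gamma(P\times_G\mathfrak{g})$ of the adjoint bundle are identified with smooth maps $X:P\to\mathfrak{g}$ satisfying $X(p\cdot g)=\mathrm{Ad}_{g^{-1}}X(p)$ for all $p\in P$, $g\in G$, and $\exp:\mathfrak{g}\to G$ is the Lie group exponential map, so that for each $t\in\mathbb{R}$ the map $p\mapsto\exp(tX(p))$ is a smooth map $f:P\to G$ with $f(p\cdot g)=g^{-1}f(p)g$. A Lie quandle is a smooth manifold $P$ with an operation $\triangleleft:P\times\mathbb{R}\times P\to P$, written $(x,t,y)\mapsto x\triangleleft_t y$, such that for all $x,y,z\in P$ and $s,t\in\mathbb{R}$: (self-action) $(x\triangleleft_{t} y)\triangleleft_{s}y=x\triangleleft_{s+t}y$; (self-distributivity) $(x\triangleleft_{t} y)\triangleleft_{s}z=(x\triangleleft_{s}z)\triangleleft_{t}(y\triangleleft_{s}z)$; (idempotency) $x\triangleleft_{s}x=x$.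 A Noether quandle is a Lie quandle $(P,\triangleleft)$ such that for all $p_1,p_2\in P$: $\bigl(p_{1}\triangleleft_{t} p_{2}=p_{1}$ for all $t\in\mathbb{R}\bigr)$ if and only if $\bigl(p_{2}\triangleleft_{t} p_{1}=p_{2}$ for all $t\in\mathbb{R}\bigr)$. *)

theory Defs
  imports "HOL-Analysis.Analysis" "HOL-Algebra.Group"
begin

text \<open>
  The class \<open>euclidean_space\<close> excludes dimension 0, and with it discrete Lie groups and
  zero-dimensional base manifolds. The following class has the same axioms except that the
  orthonormal basis may be empty.
\<close>

class euclidean_model = real_inner +
  assumes ex_orthonormal_basis:
    "\<exists>B. finite B \<and> (\<forall>u\<in>B. \<forall>v\<in>B. inner u v = (if u = v then 1 else 0)) \<and>
         (\<forall>x. (\<forall>u\<in>B. inner x u = 0) \<longrightarrow> x = 0)"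

instance euclidean_space \<subseteq> euclidean_model
proof
  show "\<exists>B::'a set. finite B \<and> (\<forall>u\<in>B. \<forall>v\<in>B. inner u v = (if u = v then 1 else 0)) \<and>
         (\<forall>x. (\<forall>u\<in>B. inner x u = 0) \<longrightarrow> x = 0)"
    by (rule exI[of _ Basis]) (auto simp: inner_Basis euclidean_all_zero_iff)
qed

instantiation unit :: euclidean_model
begin

definition scaleR_unit :: "real \<Rightarrow> unit \<Rightarrow> unit" where "scaleR_unit r x = ()"
definition plus_unit :: "unit \<Rightarrow> unit \<Rightarrow> unit" where "plus_unit x y = ()"
definition minus_unit :: "unit \<Rightarrow> unit \<Rightarrow> unit" where "minus_unit x y = ()"
definition uminus_unit :: "unit \<Rightarrow> unit" where "uminus_unit x = ()"
definition zero_unit :: unit where "zero_unit = ()"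
definition sgn_unit :: "unit \<Rightarrow> unit" where "sgn_unit x = ()"
definition norm_unit :: "unit \<Rightarrow> real" where "norm_unit x = 0"
definition dist_unit :: "unit \<Rightarrow> unit \<Rightarrow> real" where "dist_unit x y = 0"
definition inner_unit :: "unit \<Rightarrow> unit \<Rightarrow> real" where "inner_unit x y = 0"
definition uniformity_unit :: "(unit \<times> unit) filter" where
  "uniformity_unit = (INF e\<in>{0 <..}. principal {(x, y). dist x y < e})"
definition open_unit :: "unit set \<Rightarrow> bool" where "open_unit U \<longleftrightarrow> True"

instance
proof
  show "open U \<longleftrightarrow> (\<forall>x\<in>U. \<forall>\<^sub>F (x', y) in uniformity. x' = x \<longrightarrow> y \<in> U)" for U :: "unit set"
    unfolding uniformity_unit_def open_unit_def by (auto intro!: always_eventually)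
  show "\<exists>B::unit set. finite B \<and> (\<forall>u\<in>B. \<forall>v\<in>B. inner u v = (if u = v then 1 else 0)) \<and>
         (\<forall>x. (\<forall>u\<in>B. inner x u = 0) \<longrightarrow> x = 0)"
    by (rule exI[of _ "{}"]) auto
qed (auto simp: norm_unit_def dist_unit_def inner_unit_def uniformity_unit_def)

end

text \<open>Both definitions are meant for open \<open>S\<close> in a finite-dimensional space, where they say that
  all iterated directional derivatives of order at most \<open>k\<close>, respectively of every order, exist
  and are continuous.\<close>

primrec k_smooth_on ::
  "nat \<Rightarrow> 'a::real_normed_vector set \<Rightarrow> ('a \<Rightarrow> 'b::real_normed_vector) \<Rightarrow> bool" where
  "k_smooth_on 0 S f \<longleftrightarrow> continuous_on S f"
| "k_smooth_on (Suc k) S f \<longleftrightarrow> (\<forall>x\<in>S. f differentiable (at x)) \<and>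
     (\<forall>v. k_smooth_on k S (\<lambda>x. frechet_derivative f (at x) v))"

definition smooth_on ::
  "'a::real_normed_vector set \<Rightarrow> ('a \<Rightarrow> 'b::real_normed_vector) \<Rightarrow> bool" where
  "smooth_on S f \<longleftrightarrow> (\<forall>k. k_smooth_on k S f)"

text \<open>A chart is a pair \<open>(U, \<phi>)\<close>; the values of \<open>\<phi>\<close> outside \<open>U\<close> are irrelevant.\<close>

type_synonym ('a, 'e) chart = "'a set \<times> ('a \<Rightarrow> 'e)"

record ('a, 'e) manifold =
  mtop :: "'a topology"
  atlas :: "('a, 'e) chart set"

abbreviation points :: "('a, 'e) manifold \<Rightarrow> 'a set" where
  "points M \<equiv> topspace (mtop M)"

abbreviation chart_inv :: "('a, 'e) chart \<Rightarrow> 'e \<Rightarrow> 'a" where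
  "chart_inv c \<equiv> inv_into (fst c) (snd c)"

definition is_chart :: "'a topology \<Rightarrow> ('a, 'e::real_normed_vector) chart \<Rightarrow> bool" where
  "is_chart T c \<longleftrightarrow> openin T (fst c) \<and> open (snd c ` fst c) \<and>
     homeomorphic_map (subtopology T (fst c)) (top_of_set (snd c ` fst c)) (snd c)"

definition smooth_manifold :: "('a, 'e::euclidean_model) manifold \<Rightarrow> bool" where
  "smooth_manifold M \<longleftrightarrow> Hausdorff_space (mtop M) \<and> second_countable (mtop M) \<and>
     (\<forall>c\<in>atlas M. is_chart (mtop M) c) \<and> (\<Union>c\<in>atlas M. fst c) = points M \<and>
     (\<forall>c\<in>atlas M. \<forall>d\<in>atlas M. smooth_on (snd c ` (fst c \<inter> fst d)) (snd d \<circ> chart_inv c))"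

definition smooth_map :: "('a, 'e::real_normed_vector) manifold \<Rightarrow>
    ('b, 'f::real_normed_vector) manifold \<Rightarrow> ('a \<Rightarrow> 'b) \<Rightarrow> bool" where
  "smooth_map M N f \<longleftrightarrow> continuous_map (mtop M) (mtop N) f \<and>
     (\<forall>c\<in>atlas M. \<forall>d\<in>atlas N.
        smooth_on (snd c ` (fst c \<inter> f -` fst d)) (snd d \<circ> f \<circ> chart_inv c))"

definition diffeomorphism :: "('a, 'e::real_normed_vector) manifold \<Rightarrow>
    ('b, 'f::real_normed_vector) manifold \<Rightarrow> ('a \<Rightarrow> 'b) \<Rightarrow> bool" where
  "diffeomorphism M N f \<longleftrightarrow> bij_betw f (points M) (points N) \<and>
     smooth_map M N f \<and> smooth_map N M (inv_into (points M) f)"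

definition model_manifold :: "('e::real_normed_vector, 'e) manifold" where
  "model_manifold = \<lparr>mtop = euclidean, atlas = {(UNIV, id)}\<rparr>"

definition product_manifold ::
    "('a, 'e) manifold \<Rightarrow> ('b, 'f) manifold \<Rightarrow> ('a \<times> 'b, 'e \<times> 'f) manifold" where
  "product_manifold M N = \<lparr>mtop = prod_topology (mtop M) (mtop N),
     atlas = {(fst c \<times> fst d, map_prod (snd c) (snd d)) | c d. c \<in> atlas M \<and> d \<in> atlas N}\<rparr>"

definition open_submanifold :: "('a, 'e) manifold \<Rightarrow> 'a set \<Rightarrow> ('a, 'e) manifold" where
  "open_submanifold M W = \<lparr>mtop = subtopology (mtop M) W,
     atlas = {(fst c \<inter> W, snd c) | c. c \<in> atlas M}\<rparr>"

text \<open>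
  A tangent vector at \<open>p\<close> is given by its coordinates in all charts around \<open>p\<close>, which transform
  by the derivative of the change of charts. It is extended by 0 to all other pairs, so that equal
  tangent vectors are equal as functions. For a fixed chart \<open>c\<close> around \<open>p\<close>, the map
  \<open>v \<mapsto> v c\<close> is a linear isomorphism from the tangent space onto the model space.
\<close>

type_synonym ('a, 'e) tangent = "('a, 'e) chart \<Rightarrow> 'e"

definition charts_at :: "('a, 'e) manifold \<Rightarrow> 'a \<Rightarrow> ('a, 'e) chart set" where
  "charts_at M p = {c \<in> atlas M. p \<in> fst c}"

definition tangent_space ::
    "('a, 'e::real_normed_vector) manifold \<Rightarrow> 'a \<Rightarrow> ('a, 'e) tangent set" where
  "tangent_space M p = {v. (\<forall>c. c \<notin> charts_at M p \<longrightarrow> v c = 0) \<and>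
     (\<forall>c\<in>charts_at M p. \<forall>d\<in>charts_at M p.
        v d = frechet_derivative (snd d \<circ> chart_inv c) (at (snd c p)) (v c))}"

definition tscale ::
    "real \<Rightarrow> ('a, 'e::real_normed_vector) tangent \<Rightarrow> ('a, 'e) tangent" where
  "tscale t v = (\<lambda>c. t *\<^sub>R v c)"

definition tangent_map :: "('a, 'e::real_normed_vector) manifold \<Rightarrow>
    ('b, 'f::real_normed_vector) manifold \<Rightarrow> ('a \<Rightarrow> 'b) \<Rightarrow> 'a \<Rightarrow> ('a, 'e) tangent \<Rightarrow>
    ('b, 'f) tangent" where
  "tangent_map M N f p v = (\<lambda>d. if d \<in> charts_at N (f p)
     then (let c = (SOME c. c \<in> charts_at M p)
           in frechet_derivative (snd d \<circ> f \<circ> chart_inv c) (at (snd c p)) (v c))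
     else 0)"

definition velocity ::
    "('a, 'e::real_normed_vector) manifold \<Rightarrow> (real \<Rightarrow> 'a) \<Rightarrow> real \<Rightarrow> ('a, 'e) tangent" where
  "velocity M \<gamma> t = (\<lambda>d. if d \<in> charts_at M (\<gamma> t)
     then vector_derivative (snd d \<circ> \<gamma>) (at t) else 0)"

record ('a, 'e) lie_grp = "'a monoid" +
  mfd :: "('a, 'e) manifold"

definition lie_group :: "('g, 'e::euclidean_model) lie_grp \<Rightarrow> bool" where
  "lie_group G \<longleftrightarrow> group G \<and> smooth_manifold (mfd G) \<and> points (mfd G) = carrier G \<and>
     smooth_map (product_manifold (mfd G) (mfd G)) (mfd G) (\<lambda>(x, y). x \<otimes>\<^bsub>G\<^esub> y) \<and>
     smooth_map (mfd G) (mfd G) (\<lambda>x. inv\<^bsub>G\<^esub> x)"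

definition lie_algebra :: "('g, 'e::real_normed_vector) lie_grp \<Rightarrow> ('g, 'e) tangent set" where
  "lie_algebra G = tangent_space (mfd G) \<one>\<^bsub>G\<^esub>"

text \<open>Smoothness of a map into the vector space \<open>lie_algebra G\<close> is expressed in the linear
  coordinates \<open>v \<mapsto> v c\<close>.\<close>

definition smooth_into_lie_algebra :: "('p, 'f::real_normed_vector) manifold \<Rightarrow>
    ('g, 'e::real_normed_vector) lie_grp \<Rightarrow> ('p \<Rightarrow> ('g, 'e) tangent) \<Rightarrow> bool" where
  "smooth_into_lie_algebra P G X \<longleftrightarrow> (\<forall>p\<in>points P. X p \<in> lie_algebra G) \<and>
     (\<forall>c\<in>charts_at (mfd G) \<one>\<^bsub>G\<^esub>. smooth_map P model_manifold (\<lambda>p. X p c))"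

definition Ad :: "('g, 'e::real_normed_vector) lie_grp \<Rightarrow> 'g \<Rightarrow>
    ('g, 'e) tangent \<Rightarrow> ('g, 'e) tangent" where
  "Ad G g = tangent_map (mfd G) (mfd G) (\<lambda>x. g \<otimes>\<^bsub>G\<^esub> x \<otimes>\<^bsub>G\<^esub> inv\<^bsub>G\<^esub> g) \<one>\<^bsub>G\<^esub>"

definition one_parameter_subgroup ::
    "('g, 'e::real_normed_vector) lie_grp \<Rightarrow> (real \<Rightarrow> 'g) \<Rightarrow> bool" where
  "one_parameter_subgroup G \<gamma> \<longleftrightarrow> smooth_map model_manifold (mfd G) \<gamma> \<and>
     (\<forall>s t. \<gamma> (s + t) = \<gamma> s \<otimes>\<^bsub>G\<^esub> \<gamma> t)"

definition lie_exp ::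
    "('g, 'e::real_normed_vector) lie_grp \<Rightarrow> ('g, 'e) tangent \<Rightarrow> 'g" where
  "lie_exp G v = (THE \<gamma>. one_parameter_subgroup G \<gamma> \<and> velocity (mfd G) \<gamma> 0 = v) 1"

definition smooth_right_action :: "('g, 'e::real_normed_vector) lie_grp \<Rightarrow>
    ('p, 'f::real_normed_vector) manifold \<Rightarrow> ('p \<Rightarrow> 'g \<Rightarrow> 'p) \<Rightarrow> bool" where
  "smooth_right_action G P act \<longleftrightarrow>
     smooth_map (product_manifold P (mfd G)) P (\<lambda>(p, g). act p g) \<and>
     (\<forall>p\<in>points P. act p \<one>\<^bsub>G\<^esub> = p) \<and>
     (\<forall>p\<in>points P. \<forall>g\<in>carrier G. \<forall>h\<in>carrier G. act (act p g) h = act p (g \<otimes>\<^bsub>G\<^esub> h))"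

definition local_trivialization :: "('g, 'e::real_normed_vector) lie_grp \<Rightarrow>
    ('p, 'f::real_normed_vector) manifold \<Rightarrow> ('m, 'h::real_normed_vector) manifold \<Rightarrow>
    ('p \<Rightarrow> 'm) \<Rightarrow> ('p \<Rightarrow> 'g \<Rightarrow> 'p) \<Rightarrow> 'm set \<Rightarrow> ('p \<Rightarrow> 'm \<times> 'g) \<Rightarrow> bool" where
  "local_trivialization G P M \<pi> act U \<Phi> \<longleftrightarrow> openin (mtop M) U \<and>
     diffeomorphism (open_submanifold P {p \<in> points P. \<pi> p \<in> U})
       (product_manifold (open_submanifold M U) (mfd G)) \<Phi> \<and>
     (\<forall>p\<in>points P. \<pi> p \<in> U \<longrightarrow> fst (\<Phi> p) = \<pi> p \<and>
        (\<forall>g\<in>carrier G. \<Phi> (act p g) = (fst (\<Phi> p), snd (\<Phi> p) \<otimes>\<^bsub>G\<^esub> g)))"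

definition principal_bundle :: "('g, 'e::euclidean_model) lie_grp \<Rightarrow>
    ('p, 'f::euclidean_model) manifold \<Rightarrow> ('m, 'h::euclidean_model) manifold \<Rightarrow>
    ('p \<Rightarrow> 'm) \<Rightarrow> ('p \<Rightarrow> 'g \<Rightarrow> 'p) \<Rightarrow> bool" where
  "principal_bundle G P M \<pi> act \<longleftrightarrow>
     lie_group G \<and> smooth_manifold P \<and> smooth_manifold M \<and>
     smooth_map P M \<pi> \<and> smooth_right_action G P act \<and>
     (\<forall>p\<in>points P. \<forall>g\<in>carrier G. \<pi> (act p g) = \<pi> p) \<and>
     (\<forall>x\<in>points M. \<exists>U \<Phi>. x \<in> U \<and> local_trivialization G P M \<pi> act U \<Phi>)"

text \<open>Sections of the adjoint bundle are represented by the corresponding equivariant maps from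
  the total space to the Lie algebra.\<close>

definition adjoint_section :: "('g, 'e::euclidean_model) lie_grp \<Rightarrow>
    ('p, 'f::euclidean_model) manifold \<Rightarrow> ('p \<Rightarrow> 'g \<Rightarrow> 'p) \<Rightarrow>
    ('p \<Rightarrow> ('g, 'e) tangent) \<Rightarrow> bool" where
  "adjoint_section G P act X \<longleftrightarrow>
     smooth_into_lie_algebra P G X \<and>
     (\<forall>p\<in>points P. \<forall>g\<in>carrier G. X (act p g) = Ad G (inv\<^bsub>G\<^esub> g) (X p))"

text \<open>The operation \<open>(x, t, y) \<mapsto> x \<triangleleft>\<^sub>t y\<close> is written \<open>op x t y\<close>.\<close>

definition lie_quandle ::
    "('p, 'f::euclidean_model) manifold \<Rightarrow> ('p \<Rightarrow> real \<Rightarrow> 'p \<Rightarrow> 'p) \<Rightarrow> bool" where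
  "lie_quandle P op \<longleftrightarrow> smooth_manifold P \<and>
     (\<forall>x\<in>points P. \<forall>y\<in>points P. \<forall>t. op x t y \<in> points P) \<and>
     (\<forall>x\<in>points P. \<forall>y\<in>points P. \<forall>s t. op (op x t y) s y = op x (s + t) y) \<and>
     (\<forall>x\<in>points P. \<forall>y\<in>points P. \<forall>z\<in>points P. \<forall>s t.
        op (op x t y) s z = op (op x s z) t (op y s z)) \<and>
     (\<forall>x\<in>points P. \<forall>s. op x s x = x)"

definition noether_quandle ::
    "('p, 'f::euclidean_model) manifold \<Rightarrow> ('p \<Rightarrow> real \<Rightarrow> 'p \<Rightarrow> 'p) \<Rightarrow> bool" where
  "noether_quandle P op \<longleftrightarrow> lie_quandle P op \<and>
     (\<forall>x\<in>points P. \<forall>y\<in>points P. (\<forall>t. op x t y = x) \<longleftrightarrow> (\<forall>t. op y t x = y))"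

definition gauge_op :: "('g, 'e::real_normed_vector) lie_grp \<Rightarrow> ('p \<Rightarrow> 'g \<Rightarrow> 'p) \<Rightarrow>
    ('p \<Rightarrow> ('g, 'e) tangent) \<Rightarrow> 'p \<Rightarrow> real \<Rightarrow> 'p \<Rightarrow> 'p" where
  "gauge_op G act X x t y =
     act x (lie_exp G (tscale (- t) (X x)) \<otimes>\<^bsub>G\<^esub> lie_exp G (tscale t (X y)))"

end

(*
A one-parameter subgroup is a curve whose left logarithmic derivative, the velocity at s = t of
s |-> a(t)^-1 a(s), is the same vector for all t. If a and b are two such curves with the same
vector, then a(t) b(t)^-1 has zero velocity everywhere, so it is constant; this replaces the
uniqueness theorem for ordinary differential equations. Existence is Picard-Lindelof in a chart at
the unit; the local solution is a local homomorphism by the uniqueness argument, and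
t |-> a(t/n)^n extends it to the real line. Thus t |-> exp(tv) is a homomorphism and
exp(t Ad_g v) = g exp(tv) g^-1.

With E_p(t) = exp(t X(p)), equivariance of X reads E_(p.g)(t) = g^-1 E_p(t) g, and the quandle
axioms are computations in the group. Since the action is free, x <|_t y = x means
E_x(t) = E_y(t), which is symmetric in x and y.
*)

theory Submission
  imports Defs
begin

section \<open>Functions with continuous iterated derivatives\<close>

text \<open>\<open>lie_exp\<close> is a definite description, so nothing can be said about it before
  existence and uniqueness of one-parameter subgroups are both available; most of the development
  serves that end. The derivatives of multiplication and inversion are never computed. The chain
  rule shows that the velocity of an image curve depends only on the position and velocity of the
  original curve, and the unknown value is found by inserting a second curve with the same data
  whose image is explicit: one whose image is constant in the uniqueness argument, a straight
  coordinate line through the unit in the existence argument. Quotients of curves are preferred to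
  differential equations for uniqueness because a solution may leave the chart in which its equation
  is posed, whereas the quotient can be examined in whatever chart contains it. Smoothness is
  defined by derivatives in fixed directions. This suits products and affine substitutions, but in
  the chain rule the direction moves with the point; an orthonormal basis reduces that case to a
  finite sum.\<close>

lemma k_smooth_on_cong:
  assumes "open S" "\<And>x. x \<in> S \<Longrightarrow> f x = g x" "k_smooth_on k S f"
  shows "k_smooth_on k S g"
  using assms(2,3)
proof (induction k arbitrary: f g)
  case 0
  then show ?case by (metis continuous_on_cong k_smooth_on.simps(1))
next
  case (Suc k)
  have d: "f differentiable (at x)" if "x \<in> S" for x
    using Suc.prems(2) that by simp
  have e: "g differentiable (at x)" if "x \<in> S" for x
  proof -
    have "(f has_derivative frechet_derivative f (at x)) (at x)"
      using d[OF that] by (simp add: frechet_derivative_works)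
    then have "(g has_derivative frechet_derivative f (at x)) (at x)"
      by (rule has_derivative_transform_within_open[OF _ assms(1) that]) (simp add: Suc.prems(1))
    then show ?thesis by (rule differentiableI)
  qed
  have "k_smooth_on k S (\<lambda>x. frechet_derivative g (at x) v)" for v
  proof (rule Suc.IH)
    show "k_smooth_on k S (\<lambda>x. frechet_derivative f (at x) v)" using Suc.prems(2) by simp
    show "frechet_derivative f (at x) v = frechet_derivative g (at x) v" if "x \<in> S" for x
      by (rule fun_cong[OF frechet_derivative_transform_within_open[OF d[OF that] assms(1) that
          Suc.prems(1)]])
  qed
  with e show ?case by simp
qed

lemma k_smooth_on_subset: "k_smooth_on k S f \<Longrightarrow> T \<subseteq> S \<Longrightarrow>
    k_smooth_on k T f"
proof (induction k arbitrary: f)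
  case 0
  then show ?case using continuous_on_subset by (metis k_smooth_on.simps(1))
next
  case (Suc k)
  then show ?case by (simp add: subset_iff)
qed

text \<open>Differentiability at a point and continuity on open sets are local. The neighbourhood
  may depend on the point, which is what lets the intermediate chart of a composite change from
  point to point.\<close>

lemma k_smooth_on_local:
  assumes "\<And>x. x \<in> S \<Longrightarrow> \<exists>T. open T \<and> x \<in> T \<and>
      k_smooth_on k T f"
  shows "k_smooth_on k S f"
  using assms
proof (induction k arbitrary: f)
  case 0
  have "isCont f x" if "x \<in> S" for x
    using 0[OF that] by (metis continuous_on_eq_continuous_at k_smooth_on.simps(1))
  then show ?case by (simp add: continuous_at_imp_continuous_on)
next
  case (Suc k)
  have "f differentiable (at x)" if "x \<in> S" for x
    using Suc.prems[OF that] by auto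
  moreover have "k_smooth_on k S (\<lambda>x. frechet_derivative f (at x) v)" for v
  proof (rule Suc.IH)
    fix x assume "x \<in> S"
    from Suc.prems[OF this] show "\<exists>T. open T \<and> x \<in> T \<and> k_smooth_on k T
        (\<lambda>x. frechet_derivative f (at x) v)"
      by (metis k_smooth_on.simps(2))
  qed
  ultimately show ?case by simp
qed

text \<open>The definition at \<open>Suc k\<close> speaks of differentiability and of derivatives of
  order \<open>k\<close> only, so the lower order has to be recovered; the base case is that
  differentiable maps are continuous.\<close>

lemma k_smooth_on_Suc_lower: "k_smooth_on (Suc k) S f \<Longrightarrow> k_smooth_on k S f"
proof (induction k arbitrary: f)
  case 0
  then have "\<forall>x\<in>S. f differentiable (at x)" by simp
  then have "\<forall>x\<in>S. isCont f x" using differentiable_imp_continuous_within by metis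
  then show ?case by (simp add: continuous_at_imp_continuous_on)
next
  case (Suc k)
  have "k_smooth_on k S (\<lambda>x. frechet_derivative f (at x) v)" for v
    by (rule Suc.IH) (use Suc.prems in simp)
  then show ?case using Suc.prems by simp
qed

lemma k_smooth_on_continuous: "k_smooth_on k S f \<Longrightarrow> continuous_on S f"
proof (induction k)
  case (Suc k)
  from Suc.IH[OF k_smooth_on_Suc_lower[OF Suc.prems]] show ?case .
qed simp

text \<open>Replaces \<open>frechet_derivative\<close>, which is given by choice, with any explicit
  derivative formula. The closure properties below are inductions through this rule.\<close>

lemma k_smooth_on_SucI:
  assumes "open S" "\<And>x. x \<in> S \<Longrightarrow> (f has_derivative f' x) (at x)"
    and "\<And>v. k_smooth_on k S (\<lambda>x. f' x v)"
  shows "k_smooth_on (Suc k) S f"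
proof -
  have "k_smooth_on k S (\<lambda>x. frechet_derivative f (at x) v)" for v
    by (rule k_smooth_on_cong[OF assms(1) _ assms(3)[of v]])
      (use frechet_derivative_at[OF assms(2)] in \<open>simp add: fun_eq_iff\<close>)
  then show ?thesis using assms(2) by (auto intro: differentiableI)
qed

lemma k_smooth_on_has_derivative:
  "k_smooth_on (Suc k) S f \<Longrightarrow> x \<in> S \<Longrightarrow> (f has_derivative
      frechet_derivative f (at x)) (at x)"
  by (simp add: frechet_derivative_works)

lemma k_smooth_on_derivative:
  "k_smooth_on (Suc k) S f \<Longrightarrow> k_smooth_on k S (\<lambda>x. frechet_derivative f (at x) v)"
  by simp

lemma k_smooth_on_const: "k_smooth_on k S (\<lambda>x. c)"
proof (induction k arbitrary: c)
  case (Suc k)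
  then show ?case by (simp add: frechet_derivative_const)
qed simp

lemma k_smooth_on_add:
  assumes "open S"
  shows "k_smooth_on k S f \<Longrightarrow> k_smooth_on k S g \<Longrightarrow> k_smooth_on k S
      (\<lambda>x. f x + g x)"
proof (induction k arbitrary: f g)
  case 0
  then show ?case by (simp add: continuous_on_add)
next
  case (Suc k)
  show ?case
  proof (rule k_smooth_on_SucI[OF assms])
    show "((\<lambda>x. f x + g x) has_derivative
      (\<lambda>v. frechet_derivative f (at x) v + frechet_derivative g (at x) v)) (at x)" if "x
          \<in> S" for x
      using Suc.prems that by (intro has_derivative_add k_smooth_on_has_derivative)
    show "k_smooth_on k S (\<lambda>x. frechet_derivative f (at x) v + frechet_derivative g (at x)
        v)" for v
      using Suc by simp
  qed
qed

lemma k_smooth_on_scaleR: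
  assumes "open S"
  shows "k_smooth_on k S f \<Longrightarrow> k_smooth_on k S g \<Longrightarrow> k_smooth_on k S
      (\<lambda>x. f x *\<^sub>R g x)"
proof (induction k arbitrary: f g)
  case 0
  then show ?case by (simp add: continuous_on_scaleR)
next
  case (Suc k)
  show ?case
  proof (rule k_smooth_on_SucI[OF assms])
    show "((\<lambda>x. f x *\<^sub>R g x) has_derivative
      (\<lambda>v. f x *\<^sub>R frechet_derivative g (at x) v + frechet_derivative f (at x) v
          *\<^sub>R g x)) (at x)" if "x \<in> S" for x
      using Suc.prems that by (intro has_derivative_scaleR k_smooth_on_has_derivative)
    show "k_smooth_on k S (\<lambda>x. f x *\<^sub>R frechet_derivative g (at x) v +
        frechet_derivative f (at x) v *\<^sub>R g x)" for v
      by (intro k_smooth_on_add[OF assms] Suc.IH k_smooth_on_derivative[OF Suc.prems(1)]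
          k_smooth_on_derivative[OF Suc.prems(2)] k_smooth_on_Suc_lower[OF Suc.prems(1)]
          k_smooth_on_Suc_lower[OF Suc.prems(2)])
  qed
qed

lemma k_smooth_on_sum:
  assumes "open S" "finite B" "\<And>b. b \<in> B \<Longrightarrow> k_smooth_on k S (f b)"
  shows "k_smooth_on k S (\<lambda>x. \<Sum>b\<in>B. f b x)"
  using assms(2,3)
proof (induction B rule: finite_induct)
  case empty
  then show ?case by (simp add: k_smooth_on_const)
next
  case (insert b B)
  then show ?case by (simp add: k_smooth_on_add[OF assms(1)])
qed

text \<open>The inner derivative \<open>L v\<close> is the same at every point, so the direction
  stays fixed and the induction closes without a basis. Hence \<open>f\<close> may live on any
  normed space, in particular on a product of two model spaces, where multiplication is expressed in
  coordinates.\<close>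

lemma k_smooth_on_affine_compose:
  assumes "open T" "bounded_linear L" "\<And>x. x \<in> T \<Longrightarrow> a + L x \<in> S"
  shows "k_smooth_on k S f \<Longrightarrow> k_smooth_on k T (\<lambda>x. f (a + L x))"
proof (induction k arbitrary: f)
  case 0
  have "continuous_on T (\<lambda>x. a + L x)"
    by (intro continuous_intros linear_continuous_on assms)
  moreover have "(\<lambda>x. a + L x) ` T \<subseteq> S" using assms(3) by (simp add: image_subset_iff)
  ultimately show ?case using 0 continuous_on_compose2 k_smooth_on.simps(1) by metis
next
  case (Suc k)
  show ?case
  proof (rule k_smooth_on_SucI[OF assms(1)])
    show "((\<lambda>x. f (a + L x)) has_derivative (\<lambda>v. frechet_derivative f (at (a + L x))
        (L v))) (at x)"
      if "x \<in> T" for x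
    proof (rule has_derivative_compose[where f = "\<lambda>x. a + L x" and g = f])
      show "((\<lambda>x. a + L x) has_derivative L) (at x)"
        using has_derivative_add[OF has_derivative_const bounded_linear_imp_has_derivative[OF assms(2)]]
        by simp
      show "(f has_derivative frechet_derivative f (at (a + L x))) (at (a + L x))"
        using Suc.prems assms(3)[OF that] by (rule k_smooth_on_has_derivative)
    qed
    show "k_smooth_on k T (\<lambda>x. frechet_derivative f (at (a + L x)) (L v))" for v
      by (rule Suc.IH) (use Suc.prems in simp)
  qed
qed

lemma k_smooth_on_linear_compose:
  assumes "open S" "bounded_linear L"
  shows "k_smooth_on k S f \<Longrightarrow> k_smooth_on k S (\<lambda>x. L (f x))"
proof (induction k arbitrary: f)
  case 0
  then show ?case using assms(2) by (simp add: bounded_linear.continuous_on)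
next
  case (Suc k)
  show ?case
  proof (rule k_smooth_on_SucI[OF assms(1)])
    show "((\<lambda>x. L (f x)) has_derivative (\<lambda>v. L (frechet_derivative f (at x) v))) (at
        x)" if "x \<in> S" for x
      using Suc.prems that by (intro bounded_linear.has_derivative[OF assms(2)]
          k_smooth_on_has_derivative)
    show "k_smooth_on k S (\<lambda>x. L (frechet_derivative f (at x) v))" for v
      by (rule Suc.IH) (use Suc.prems in simp)
  qed
qed

section \<open>Orthonormal expansion, the general chain rule and completeness of model
  spaces\<close>

definition model_basis :: "'a::euclidean_model set" where
  "model_basis = (SOME B. finite B \<and> (\<forall>u\<in>B. \<forall>v\<in>B. inner u v = (if u = v
      then 1 else 0)) \<and>
         (\<forall>x. (\<forall>u\<in>B. inner x u = 0) \<longrightarrow> x = 0))"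

lemma model_basis:
  "finite (model_basis :: 'a::euclidean_model set)"
  "\<And>u v :: 'a. u \<in> model_basis \<Longrightarrow> v \<in> model_basis \<Longrightarrow>
      inner u v = (if u = v then 1 else 0)"
  "\<And>x :: 'a. (\<And>u. u \<in> model_basis \<Longrightarrow> inner x u = 0) \<Longrightarrow> x = 0"
  using someI_ex[OF ex_orthonormal_basis[where 'a = 'a]]
  unfolding model_basis_def[symmetric] by simp_all

text \<open>The difference of the two sides is orthogonal to every basis vector, hence zero by the
  maximality clause of the class.\<close>

lemma model_basis_expansion: "(\<Sum>b\<in>model_basis. inner x b *\<^sub>R b) = (x ::
    'a::euclidean_model)"
proof -
  have "x - (\<Sum>b\<in>model_basis. inner x b *\<^sub>R b) = 0"
  proof (rule model_basis(3))
    fix u :: 'a assume u: "u \<in> model_basis"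
    have "inner (\<Sum>b\<in>model_basis. inner x b *\<^sub>R b) u = (\<Sum>b\<in>model_basis. if b
        = u then inner x b else 0)"
      by (simp add: inner_sum_left) (intro sum.cong, auto simp: model_basis(2) u)
    also have "\<dots> = inner x u"
      using u by (simp add: model_basis(1))
    finally show "inner (x - (\<Sum>b\<in>model_basis. inner x b *\<^sub>R b)) u = 0"
      by (simp add: inner_diff_left)
  qed
  then show ?thesis by simp
qed

text \<open>The direction in which \<open>g\<close> is differentiated is the derivative of
  \<open>f\<close>, which varies with \<open>x\<close>, while the induction hypothesis covers fixed
  directions only. Expanding it in the basis gives a finite sum of scalar coefficients times
  derivatives of \<open>g\<close> in basis directions.\<close>

lemma k_smooth_on_compose:
  fixes g :: "'b::euclidean_model \<Rightarrow> 'c::real_normed_vector"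
  assumes "open S"
  shows "k_smooth_on k S f \<Longrightarrow> k_smooth_on k T g \<Longrightarrow> f ` S \<subseteq> T
      \<Longrightarrow> k_smooth_on k S (\<lambda>x. g (f x))"
proof (induction k arbitrary: g)
  case 0
  then show ?case using continuous_on_compose2 k_smooth_on.simps(1) by metis
next
  case (Suc k)
  show ?case
  proof (rule k_smooth_on_SucI[OF assms])
    fix x assume x: "x \<in> S"
    have fx: "f x \<in> T" using x Suc.prems(3) by auto
    note Dg = k_smooth_on_has_derivative[OF Suc.prems(2) fx]
    note Df = k_smooth_on_has_derivative[OF Suc.prems(1) x]
    have D: "((\<lambda>x. g (f x)) has_derivative (\<lambda>v. frechet_derivative g (at (f x))
        (frechet_derivative f (at x) v))) (at x)"
      using has_derivative_compose[OF Df Dg] .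
    have lin: "linear (frechet_derivative g (at (f x)))"
      using Dg by (rule has_derivative_linear)
    have "frechet_derivative g (at (f x)) w = (\<Sum>b\<in>model_basis. inner w b *\<^sub>R
        frechet_derivative g (at (f x)) b)" for w
    proof -
      have "frechet_derivative g (at (f x)) (\<Sum>b\<in>model_basis. inner w b *\<^sub>R b)
        = (\<Sum>b\<in>model_basis. inner w b *\<^sub>R frechet_derivative g (at (f x)) b)"
        using lin by (simp add: linear_sum linear_cmul)
      then show ?thesis by (simp add: model_basis_expansion)
    qed
    then have eq: "(\<lambda>v. frechet_derivative g (at (f x)) (frechet_derivative f (at x) v)) =
        (\<lambda>v. \<Sum>b\<in>model_basis. inner (frechet_derivative f (at x) v) b *\<^sub>R
            frechet_derivative g (at (f x)) b)"
      by (intro ext)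
    show "((\<lambda>x. g (f x)) has_derivative
      (\<lambda>v. \<Sum>b\<in>model_basis. inner (frechet_derivative f (at x) v) b *\<^sub>R
          frechet_derivative g (at (f x)) b)) (at x)"
      using D unfolding eq .
  next
    fix v
    have 1: "k_smooth_on k S (\<lambda>x. inner (frechet_derivative f (at x) v) b)" for b
      by (rule k_smooth_on_linear_compose[OF assms bounded_linear_inner_left])
        (rule k_smooth_on_derivative[OF Suc.prems(1)])
    have 2: "k_smooth_on k S (\<lambda>x. frechet_derivative g (at (f x)) b)" for b
      by (rule Suc.IH[OF k_smooth_on_Suc_lower[OF Suc.prems(1)] k_smooth_on_derivative[OF
          Suc.prems(2)] Suc.prems(3)])
    show "k_smooth_on k S (\<lambda>x. \<Sum>b\<in>model_basis. inner (frechet_derivative f (at x)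
        v) b *\<^sub>R frechet_derivative g (at (f x)) b)"
      by (intro k_smooth_on_sum[OF assms] model_basis(1) k_smooth_on_scaleR[OF assms] 1 2)
  qed
qed


text \<open>The coordinates of a Cauchy sequence converge in the reals, and the expansion
  reassembles the limit. Completeness is what the integrals and the fixed point argument for
  differential equations rest on.\<close>

instance euclidean_model \<subseteq> banach
proof
  fix X :: "nat \<Rightarrow> 'a"
  assume C: "Cauchy X"
  have "Cauchy (\<lambda>n. inner (X n) b)" for b
    using bounded_linear.Cauchy[OF bounded_linear_inner_left C] .
  then have "\<exists>l. (\<lambda>n. inner (X n) b) \<longlonglongrightarrow> l" for b
    by (simp add: real_Cauchy_convergent convergent_def[symmetric])
  then obtain l where l: "\<And>b. (\<lambda>n. inner (X n) b) \<longlonglongrightarrow> l b"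
    by metis
  have "(\<lambda>n. \<Sum>b\<in>model_basis. inner (X n) b *\<^sub>R b) \<longlonglongrightarrow>
      (\<Sum>b\<in>model_basis. l b *\<^sub>R b)"
    by (intro tendsto_sum tendsto_scaleR l tendsto_const)
  then show "convergent X"
    unfolding model_basis_expansion convergent_def by blast
qed

section \<open>Local solutions of autonomous differential equations\<close>

lemma norm_inner_model_basis:
  fixes v b :: "'a::euclidean_model"
  assumes "b \<in> model_basis"
  shows "\<bar>inner v b\<bar> \<le> norm v"
proof -
  have "norm b = 1" using model_basis(2)[OF assms assms] by (simp add: norm_eq_1)
  then show ?thesis using Cauchy_Schwarz_ineq2[of v b] by simp
qed

text \<open>The derivatives in the finitely many basis directions are continuous at
  \<open>p\<close>, hence bounded near \<open>p\<close>, and together they bound the operator norm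
  of the derivative. A ball is convex, so the mean value inequality turns this bound into a
  Lipschitz constant.\<close>

lemma k_smooth_on_locally_lipschitz:
  fixes F :: "'a::euclidean_model \<Rightarrow> 'b::real_normed_vector"
  assumes W: "open W" "p \<in> W" and F: "k_smooth_on 1 W F"
  obtains r L C where "r > 0" "L \<ge> 0" "C \<ge> 0" "cball p r \<subseteq> W"
    "\<And>x. x \<in> cball p r \<Longrightarrow> norm (F x) \<le> C"
    "\<And>x y. x \<in> cball p r \<Longrightarrow> y \<in> cball p r \<Longrightarrow> norm (F x -
        F y) \<le> L * norm (x - y)"
proof -
  have F1: "k_smooth_on (Suc 0) W F" using F by simp
  have cont: "isCont g p" if "continuous_on W g" for g :: "'a \<Rightarrow> 'b"
    using that W by (metis continuous_on_eq_continuous_at)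
  have near: "eventually (\<lambda>x. norm (g x) \<le> norm (g p) + 1) (nhds p)" if g: "isCont g p"
      for g :: "'a \<Rightarrow> 'b"
  proof -
    have "((\<lambda>x. norm (g x)) \<longlongrightarrow> norm (g p)) (nhds p)"
      using g by (intro tendsto_norm) (simp add: isCont_def tendsto_nhds_iff)
    then have "eventually (\<lambda>x. norm (g x) < norm (g p) + 1) (nhds p)"
      by (rule order_tendstoD) simp
    then show ?thesis by (rule eventually_mono) simp
  qed
  define D where "D x b = frechet_derivative F (at x) b" for x b
  have ev1: "eventually (\<lambda>x. \<forall>b\<in>model_basis. norm (D x b) \<le> norm (D p b) +
      1) (nhds p)"
    by (intro eventually_ball_finite model_basis(1) ballI near cont)
      (use k_smooth_on_derivative[OF F1] in \<open>simp add: D_def\<close>)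
  have ev2: "eventually (\<lambda>x. norm (F x) \<le> norm (F p) + 1) (nhds p)"
    by (intro near cont k_smooth_on_continuous[OF F])
  have ev3: "eventually (\<lambda>x. x \<in> W) (nhds p)"
    using W by (simp add: eventually_nhds_in_open)
  from eventually_conj[OF ev1 eventually_conj[OF ev2 ev3]]
  obtain e where e: "e > 0" and
    E: "\<And>x. dist x p < e \<Longrightarrow> (\<forall>b\<in>model_basis. norm (D x b) \<le> norm
        (D p b) + 1) \<and> norm (F x) \<le> norm (F p) + 1 \<and> x \<in> W"
    unfolding eventually_nhds_metric by blast
  \<comment> \<open>The estimates hold on the open ball of radius \<open>e\<close>; halving the
    radius puts a closed ball inside it.\<close>
  define r where "r = e / 2"
  have r: "r > 0" and E': "x \<in> cball p r \<Longrightarrow> (\<forall>b\<in>model_basis. norm (D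
      x b) \<le> norm (D p b) + 1) \<and> norm (F x) \<le> norm (F p) + 1 \<and> x \<in> W" for x
    using e E[of x] by (auto simp: r_def dist_commute)
  define L where "L = (\<Sum>b\<in>model_basis. norm (D p b) + 1)"
  have L: "L \<ge> 0" unfolding L_def by (intro sum_nonneg) simp
  have on: "onorm (D x) \<le> L" if x: "x \<in> cball p r" for x
  proof (rule onorm_bound[OF L])
    fix v
    have "(F has_derivative D x) (at x)"
      using k_smooth_on_has_derivative[OF F1, of x] E'[OF x] by (simp add: D_def[abs_def])
    then have lin: "linear (D x)" by (rule has_derivative_linear)
    have "D x v = D x (\<Sum>b\<in>model_basis. inner v b *\<^sub>R b)" by (simp add:
        model_basis_expansion)
    also have "\<dots> = (\<Sum>b\<in>model_basis. inner v b *\<^sub>R D x b)"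
      using lin by (simp add: linear_sum linear_cmul)
    finally have "norm (D x v) \<le> (\<Sum>b\<in>model_basis. norm (inner v b *\<^sub>R D x b))"
      by (simp only: norm_sum)
    also have "\<dots> \<le> (\<Sum>b\<in>model_basis. norm v * (norm (D p b) + 1))"
    proof (rule sum_mono)
      fix b :: 'a assume b: "b \<in> model_basis"
      have "norm (D x b) \<le> norm (D p b) + 1" using E'[OF x] b by simp
      then show "norm (inner v b *\<^sub>R D x b) \<le> norm v * (norm (D p b) + 1)"
        using norm_inner_model_basis[OF b, of v] by (simp add: mult_mono)
    qed
    also have "\<dots> = L * norm v" by (simp add: L_def sum_distrib_left mult.commute)
    finally show "norm (D x v) \<le> L * norm v" .
  qed
  have lip: "norm (F x - F y) \<le> L * norm (x - y)" if "x \<in> cball p r" "y \<in> cball p r" for x y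
  proof (rule differentiable_bound[OF convex_cball _ on that])
    fix z assume "z \<in> cball p r"
    then show "(F has_derivative D z) (at z within cball p r)"
      using k_smooth_on_has_derivative[OF F1, of z] E'[of z]
      by (simp add: D_def[abs_def] has_derivative_at_withinI)
  qed
  show thesis
  proof (rule that[OF r L _ _ _ lip])
    show "cball p r \<subseteq> W" using E' by blast
    show "norm (F x) \<le> norm (F p) + 1" if "x \<in> cball p r" for x using E'[OF that] by blast
  qed simp
qed

text \<open>The integral from 0 to \<open>t\<close> is written as a difference of integrals starting
  at \<open>-d\<close>, so that one formula serves both signs of \<open>t\<close>. Bounding the two
  integrals separately by \<open>2 * d * C\<close> produces the generous factor 4.\<close>

lemma integral_diff_bound:
  fixes f :: "real \<Rightarrow> 'a::banach"
  assumes "continuous_on {-d..d} f" "\<And>s. s \<in> {-d..d} \<Longrightarrow> norm (f s) \<le> C"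
      "t \<in> {-d..d}" "C \<ge> 0"
  shows "norm (integral {-d..t} f - integral {-d..0} f) \<le> 4 * d * C"
proof -
  have b: "norm (integral {-d..u} f) \<le> 2 * d * C" if "u \<in> {-d..d}" for u
  proof -
    have "norm (integral {-d..u} f) \<le> C * (u - (-d))"
      by (rule integral_bound) (use that assms in \<open>auto intro: continuous_on_subset\<close>)
    also have "\<dots> \<le> C * (2 * d)"
      using that assms(4) by (intro mult_left_mono) auto
    finally show ?thesis by (simp add: mult_ac)
  qed
  have "norm (integral {-d..t} f - integral {-d..0} f) \<le> 2 * d * C + 2 * d * C"
    by (intro order_trans[OF norm_triangle_ineq4] add_mono b) (use assms(3) in auto)
  then show ?thesis by (simp add: mult_ac)
qed

lemma picard_lindelof_cball:
  fixes F :: "'a::banach \<Rightarrow> 'a"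
  assumes r: "r > 0" and L: "L \<ge> 0" and C: "C \<ge> 0"
    and bound: "\<And>x. x \<in> cball p r \<Longrightarrow> norm (F x) \<le> C"
    and lip: "\<And>x y. x \<in> cball p r \<Longrightarrow> y \<in> cball p r \<Longrightarrow>
        norm (F x - F y) \<le> L * norm (x - y)"
  obtains d y where "d > 0" "y 0 = p" "\<And>t. y t \<in> cball p r"
    "\<And>t. t \<in> {-d<..<d} \<Longrightarrow> (y has_vector_derivative F (y t)) (at t)"
proof -
  \<comment> \<open>The first bound gives \<open>4 * d * C \<le> r\<close>, so the integral operator
    preserves the ball; the second gives \<open>4 * d * L \<le> 1 / 2\<close>, so it is a
    contraction. Adding 1 keeps the denominators positive when \<open>C\<close> or \<open>L\<close>
    vanishes.\<close>
  define d where "d = min (r / (4 * (C + 1))) (1 / (8 * (L + 1)))"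
  have d: "d > 0" using r L C by (simp add: d_def add_nonneg_pos)
  have dC: "4 * d * C \<le> r"
  proof -
    have "4 * d * C \<le> 4 * (r / (4 * (C + 1))) * (C + 1)"
      using C r L by (intro mult_mono) (auto simp: d_def)
    also have "\<dots> = r" using C by (simp add: field_simps)
    finally show ?thesis .
  qed
  have dL: "4 * d * L \<le> 1 / 2"
  proof -
    have "4 * d * L \<le> 4 * (1 / (8 * (L + 1))) * (L + 1)"
      using C r L by (intro mult_mono) (auto simp: d_def)
    also have "\<dots> = 1 / 2" using L by (simp add: field_simps)
    finally show ?thesis .
  qed
  \<comment> \<open>The fixed point is sought among bounded continuous functions on the whole real
    line, so time is clamped to \<open>{-d..d}\<close>; outside this interval the integral operator
    returns constant values.\<close>
  define cl where "cl t = max (-d) (min d t)" for t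
  have cl: "cl t \<in> {-d..d}" "t \<in> {-d..d} \<Longrightarrow> cl t = t" for t using d by (auto
      simp: cl_def)
  have cl_cont: "continuous_on UNIV cl" unfolding cl_def by (intro continuous_intros)
  \<comment> \<open>Functions with values in the closed ball: a closed, hence complete, subset of
    the space of bounded continuous functions.\<close>
  define S where "S = PiC (UNIV :: real set) (\<lambda>_. cball p r)"
  have S: "y \<in> S \<longleftrightarrow> (\<forall>t. apply_bcontfun y t \<in> cball p r)" for y
    by (auto simp: S_def mem_PiC_iff)
  have "closed S" unfolding S_def by (rule closed_PiC) simp
  then have complete: "complete S" by (simp add: complete_eq_closed)
  have Fcont: "continuous_on (cball p r) F"
  proof (rule lipschitz_on_continuous_on)
    show "L-lipschitz_on (cball p r) F" using lip L by (auto simp: lipschitz_on_def dist_norm)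
  qed
  have Fy: "continuous_on {-d..d} (\<lambda>s. F (apply_bcontfun y s))" if "y \<in> S" for y
    using that S continuous_on_compose2[OF Fcont continuous_on_apply_bcontfun[of _ y]] by blast
  \<comment> \<open>The Picard operator, whose fixed points solve the integral form of the initial
    value problem for times in \<open>{-d..d}\<close>.\<close>
  define T where "T y t = p + (integral {-d..cl t} (\<lambda>s. F (apply_bcontfun y s))
      - integral {-d..0} (\<lambda>s. F (apply_bcontfun y s)))" for y t
  have Tin: "T y t \<in> cball p r" if "y \<in> S" for y t
  proof -
    have "norm (integral {-d..cl t} (\<lambda>s. F (apply_bcontfun y s)) - integral {-d..0}
        (\<lambda>s. F (apply_bcontfun y s)))
       \<le> 4 * d * C"
      by (rule integral_diff_bound[OF Fy[OF that] _ cl(1) C]) (use that S bound in blast)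
    then show ?thesis using dC by (simp add: T_def dist_norm norm_minus_commute)
  qed
  have Tcont: "continuous_on UNIV (T y)" if "y \<in> S" for y
  proof -
    have "continuous_on {-d..d} (\<lambda>t. integral {-d..t} (\<lambda>s. F (apply_bcontfun y s)))"
      by (rule indefinite_integral_continuous_1[OF integrable_continuous_real[OF Fy[OF that]]])
    from continuous_on_compose2[OF this cl_cont]
    have "continuous_on UNIV (\<lambda>t. integral {-d..cl t} (\<lambda>s. F (apply_bcontfun y s)))"
      using cl(1) by blast
    then show ?thesis unfolding T_def by (intro continuous_intros)
  qed
  have Tb: "T y \<in> bcontfun" if "y \<in> S" for y
  proof -
    have "range (T y) \<subseteq> cball p r" using Tin[OF that] by blast
    then have "bounded (range (T y))" using bounded_cball bounded_subset by blast
    then show ?thesis using Tcont[OF that] by (simp add: bcontfun_def)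
  qed
  define Q where "Q y = Bcontfun (T y)" for y
  have Q: "apply_bcontfun (Q y) = T y" if "y \<in> S" for y
    unfolding Q_def using Tb[OF that] by (rule Bcontfun_inverse)
  have "\<exists>!y\<in>S. Q y = y"
  proof (rule Banach_fix[OF complete])
    have "const_bcontfun p \<in> S" using r by (simp add: S const_bcontfun.rep_eq)
    then show "S \<noteq> {}" by blast
    show "Q ` S \<subseteq> S" using S Q Tin by fastforce
    show "dist (Q y) (Q z) \<le> (1/2) * dist y z" if y: "y \<in> S" and z: "z \<in> S" for y z
    proof (rule dist_bound)
      fix t
      let ?y = "\<lambda>s. F (apply_bcontfun y s)" and ?z = "\<lambda>s. F (apply_bcontfun z s)"
      have int: "f integrable_on {-d..u}" if "u \<in> {-d..d}" "continuous_on {-d..d} f" for u and f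
          :: "real \<Rightarrow> 'a"
        by (rule integrable_continuous_real, rule continuous_on_subset[OF that(2)]) (use that(1) in auto)
      have 0: "0 \<in> {-d..d}" using d by simp
      have "norm (integral {-d..cl t} (\<lambda>s. ?y s - ?z s) - integral {-d..0} (\<lambda>s. ?y s
          - ?z s)) \<le> 4 * d * (L * dist y z)"
      proof (rule integral_diff_bound[OF continuous_on_diff[OF Fy[OF y] Fy[OF z]] _ cl(1)])
        fix s
        have "norm (?y s - ?z s) \<le> L * norm (apply_bcontfun y s - apply_bcontfun z s)"
          using y z S by (intro lip) auto
        also have "\<dots> \<le> L * dist y z"
          using dist_bounded[of y s z] L by (intro mult_left_mono) (simp_all add: dist_norm)
        finally show "norm (?y s - ?z s) \<le> L * dist y z" .
      qed (use L in simp)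
      moreover have "integral {-d..cl t} (\<lambda>s. ?y s - ?z s) - integral {-d..0} (\<lambda>s.
          ?y s - ?z s) = T y t - T z t"
        by (simp add: T_def Henstock_Kurzweil_Integration.integral_diff[OF int[OF cl(1) Fy[OF y]]
            int[OF cl(1) Fy[OF z]]]
            Henstock_Kurzweil_Integration.integral_diff[OF int[OF 0 Fy[OF y]] int[OF 0 Fy[OF z]]])
      moreover have "4 * d * (L * dist y z) \<le> (1/2) * dist y z"
        using mult_right_mono[OF dL zero_le_dist[of y z]] by (simp add: mult_ac)
      ultimately show "dist (apply_bcontfun (Q y) t) (apply_bcontfun (Q z) t) \<le> (1/2) * dist y z"
        by (simp add: Q y z dist_norm)
    qed
  qed simp_all
  then obtain y where y: "y \<in> S" and fix_eq: "Q y = y" by blast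
  have eq: "apply_bcontfun y = T y" using Q[OF y] fix_eq by simp
  show thesis
  proof (rule that[OF d])
    have "T y 0 = p" using d by (simp add: T_def cl)
    then show "apply_bcontfun y 0 = p" by (simp only: eq)
    show "apply_bcontfun y t \<in> cball p r" for t using y S by blast
    fix t assume t: "t \<in> {-d<..<d}"
    have "((\<lambda>u. integral {-d..u} (\<lambda>s. F (apply_bcontfun y s))) has_vector_derivative
        F (apply_bcontfun y t)) (at t within {-d..d})"
      using integral_has_vector_derivative[OF Fy[OF y], of t] t by simp
    then have "((\<lambda>u. integral {-d..u} (\<lambda>s. F (apply_bcontfun y s)))
        has_vector_derivative F (apply_bcontfun y t)) (at t)"
      using t by (simp add: at_within_Icc_at)
    then have "((\<lambda>u. p + (integral {-d..u} (\<lambda>s. F (apply_bcontfun y s)) - integral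
        {-d..0} (\<lambda>s. F (apply_bcontfun y s))))
        has_vector_derivative F (apply_bcontfun y t)) (at t)"
      by (auto intro!: derivative_eq_intros)
    then show "(apply_bcontfun y has_vector_derivative F (apply_bcontfun y t)) (at t)"
      by (rule has_vector_derivative_transform_within_open[OF _ open_greaterThanLessThan t])
        (subst eq, simp add: T_def cl)
  qed
qed

text \<open>Regularity is bootstrapped: the solution is continuous, and if it is of class
  \<open>k\<close> then so is its derivative, the composite of \<open>F\<close> with the solution,
  so the solution is of class \<open>Suc k\<close>.\<close>

lemma smooth_ode_solution:
  fixes F :: "'a::euclidean_model \<Rightarrow> 'a"
  assumes "open W" "p \<in> W" "smooth_on W F"
  obtains d y where "d > 0" "y 0 = p" "\<And>t. t \<in> {-d<..<d} \<Longrightarrow> y t \<in> W"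
    "\<And>t. t \<in> {-d<..<d} \<Longrightarrow> (y has_vector_derivative F (y t)) (at t)"
        "smooth_on {-d<..<d} y"
proof -
  have F: "k_smooth_on k W F" for k using assms(3) by (simp add: smooth_on_def)
  obtain r L C where rLC: "r > 0" "L \<ge> 0" "C \<ge> 0" and sub: "cball p r \<subseteq> W" and
    b: "\<And>x. x \<in> cball p r \<Longrightarrow> norm (F x) \<le> C"
    "\<And>x y. x \<in> cball p r \<Longrightarrow> y \<in> cball p r \<Longrightarrow> norm (F x -
        F y) \<le> L * norm (x - y)"
    using k_smooth_on_locally_lipschitz[OF assms(1,2) F] by metis
  obtain d y where d: "d > 0" and y0: "y 0 = p" and yin: "\<And>t. y t \<in> cball p r"
    and D: "\<And>t. t \<in> {-d<..<d} \<Longrightarrow> (y has_vector_derivative F (y t)) (at t)"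
    by (rule picard_lindelof_cball[OF rLC b]) blast+
  have yW: "y t \<in> W" for t using yin sub by blast
  have "k_smooth_on k {-d<..<d} y" for k
  proof (induction k)
    case 0
    have "isCont y t" if "t \<in> {-d<..<d}" for t
      using D[OF that] by (rule has_vector_derivative_continuous)
    then show ?case by (simp add: continuous_at_imp_continuous_on)
  next
    case (Suc k)
    show ?case
    proof (rule k_smooth_on_SucI[OF open_greaterThanLessThan])
      show "(y has_derivative (\<lambda>v. v *\<^sub>R F (y t))) (at t)" if "t \<in> {-d<..<d}" for t
        using D[OF that] by (simp add: has_vector_derivative_def)
      show "k_smooth_on k {-d<..<d} (\<lambda>t. v *\<^sub>R F (y t))" for v
        by (intro k_smooth_on_scaleR k_smooth_on_const open_greaterThanLessThan
            k_smooth_on_compose[OF open_greaterThanLessThan Suc F]) (use yW in blast)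
    qed
  qed
  then show thesis using that[OF d y0 yW D] by (simp add: smooth_on_def)
qed

section \<open>Charts and smooth maps\<close>

lemma is_chart_openin: "is_chart T c \<Longrightarrow> openin T (fst c)"
  and is_chart_open_image: "is_chart T c \<Longrightarrow> open (snd c ` fst c)"
  by (simp_all add: is_chart_def)

lemma is_chart_subset: "is_chart T c \<Longrightarrow> fst c \<subseteq> topspace T"
  using is_chart_openin openin_subset by metis

lemma is_chart_topspace: "is_chart T c \<Longrightarrow> topspace (subtopology T (fst c)) = fst c"
  using is_chart_subset by (metis topspace_subtopology_subset)

lemma is_chart_inj: "is_chart T c \<Longrightarrow> inj_on (snd c) (fst c)"
  using is_chart_topspace homeomorphic_imp_injective_map is_chart_def by metis

lemma chart_inv_left: "is_chart T c \<Longrightarrow> x \<in> fst c \<Longrightarrow> chart_inv c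
    (snd c x) = x"
  using is_chart_inj inv_into_f_f by metis

lemma chart_inv_right: "y \<in> snd c ` fst c \<Longrightarrow> snd c (chart_inv c y) = y"
  by (rule f_inv_into_f)

lemma chart_inv_into: "y \<in> snd c ` fst c \<Longrightarrow> chart_inv c y \<in> fst c"
  by (rule inv_into_into)

text \<open>On the image of the chart the chosen inverse \<open>inv_into\<close> agrees with the
  continuous inverse that comes with the homeomorphism.\<close>

lemma continuous_map_chart_inv:
  assumes c: "is_chart T c"
  shows "continuous_map (top_of_set (snd c ` fst c)) T (chart_inv c)"
proof -
  obtain g where g: "homeomorphic_maps (subtopology T (fst c)) (top_of_set (snd c ` fst c)) (snd c) g"
    using c unfolding is_chart_def homeomorphic_map_maps by metis
  have gx: "g (snd c x) = x" if "x \<in> fst c" for x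
    using g that is_chart_topspace[OF c] unfolding homeomorphic_maps_def by metis
  have "continuous_map (top_of_set (snd c ` fst c)) T g"
    using g unfolding homeomorphic_maps_def continuous_map_in_subtopology by metis
  then show ?thesis
  proof (rule continuous_map_eq)
    fix y assume "y \<in> topspace (top_of_set (snd c ` fst c))"
    then obtain x where x: "x \<in> fst c" "y = snd c x" by auto
    then show "g y = chart_inv c y" using gx chart_inv_left[OF c] by simp
  qed
qed

lemma chart_domain_eq:
  assumes "is_chart T c"
  shows "snd c ` (fst c \<inter> f -` V) = {y \<in> snd c ` fst c. f (chart_inv c y) \<in> V}"
  using chart_inv_left[OF assms] by force

lemma open_chart_domain:
  assumes c: "is_chart T c" and f: "continuous_map T T' f" and V: "openin T' V"
  shows "open (snd c ` (fst c \<inter> f -` V))"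
proof -
  have "continuous_map (top_of_set (snd c ` fst c)) T' (f \<circ> chart_inv c)"
    using continuous_map_compose[OF continuous_map_chart_inv[OF c] f] .
  from openin_continuous_map_preimage[OF this V]
  have "openin (top_of_set (snd c ` fst c)) (snd c ` (fst c \<inter> f -` V))"
    by (simp add: chart_domain_eq[OF c])
  then show ?thesis using is_chart_open_image[OF c] openin_open_eq by metis
qed

section \<open>Charts of a product\<close>

definition prod_chart :: "('a, 'e) chart \<Rightarrow> ('b, 'f) chart \<Rightarrow> ('a \<times> 'b,
    'e \<times> 'f) chart" where
  "prod_chart c d = (fst c \<times> fst d, map_prod (snd c) (snd d))"

lemma prod_chart_simps:
  "fst (prod_chart c d) = fst c \<times> fst d" "snd (prod_chart c d) (x, y) = (snd c x, snd d y)"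
  "snd (prod_chart c d) ` fst (prod_chart c d) = (snd c ` fst c) \<times> (snd d ` fst d)"
  by (simp_all add: prod_chart_def map_prod_surj_on)

lemma prod_chart_inv:
  assumes c: "is_chart T c" and d: "is_chart T' d" and x: "x \<in> snd c ` fst c" and y: "y \<in>
      snd d ` fst d"
  shows "chart_inv (prod_chart c d) (x, y) = (chart_inv c x, chart_inv d y)"
proof -
  have "inj_on (snd (prod_chart c d)) (fst (prod_chart c d))"
    using map_prod_inj_on[OF is_chart_inj[OF c] is_chart_inj[OF d]] by (simp add: prod_chart_def)
  moreover have "(chart_inv c x, chart_inv d y) \<in> fst (prod_chart c d)"
    using x y by (simp add: prod_chart_simps chart_inv_into)
  moreover have "(x, y) = snd (prod_chart c d) (chart_inv c x, chart_inv d y)"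
    using x y by (simp add: prod_chart_simps chart_inv_right)
  ultimately show ?thesis by (metis inv_into_f_f)
qed

lemma prod_chart_inv_left:
  assumes c: "is_chart T c" and d: "is_chart T' d" and z: "z \<in> fst (prod_chart c d)"
  shows "chart_inv (prod_chart c d) (snd (prod_chart c d) z) = z"
proof -
  obtain x y where xy: "z = (x, y)" "x \<in> fst c" "y \<in> fst d"
    using z by (auto simp: prod_chart_simps(1))
  then show ?thesis
    unfolding xy prod_chart_simps(2) using prod_chart_inv[OF c d, of "snd c x" "snd d y"]
    by (simp add: chart_inv_left[OF c] chart_inv_left[OF d])
qed

lemma prod_chart_in_atlas:
  "c \<in> atlas M \<Longrightarrow> d \<in> atlas N \<Longrightarrow> prod_chart c d \<in> atlas
      (product_manifold M N)"
  unfolding product_manifold_def prod_chart_def manifold.select_convs mem_Collect_eq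
  by (intro exI[of _ c] exI[of _ d] conjI refl)

text \<open>Only the factor charts are used: pulling \<open>V\<close> back along \<open>f\<close>
  and the pair of inverse charts gives a relatively open subset of the rectangle formed by the two
  chart images, and that rectangle is open.\<close>

lemma open_prod_chart_domain:
  assumes c: "is_chart T c" and d: "is_chart T' d"
    and f: "continuous_map (prod_topology T T') T'' f" and V: "openin T'' V"
  shows "open (snd (prod_chart c d) ` (fst (prod_chart c d) \<inter> f -` V))"
proof -
  let ?A = "snd c ` fst c" and ?B = "snd d ` fst d"
  let ?i = "\<lambda>z. (chart_inv c (fst z), chart_inv d (snd z))"
  have 1: "continuous_map (top_of_set (?A \<times> ?B)) (top_of_set ?A) fst"
    by (auto simp: continuous_on_fst continuous_on_id)
  have 2: "continuous_map (top_of_set (?A \<times> ?B)) (top_of_set ?B) snd"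
    by (auto simp: continuous_on_snd continuous_on_id)
  have "continuous_map (top_of_set (?A \<times> ?B)) (prod_topology T T') ?i"
    using continuous_map_compose[OF 1 continuous_map_chart_inv[OF c]]
      continuous_map_compose[OF 2 continuous_map_chart_inv[OF d]]
    by (simp add: continuous_map_pairwise o_def)
  from openin_continuous_map_preimage[OF continuous_map_compose[OF this f] V]
  have op: "openin (top_of_set (?A \<times> ?B)) {z \<in> ?A \<times> ?B. f (?i z) \<in> V}" by simp
  have "open (?A \<times> ?B)"
    using is_chart_open_image[OF c] is_chart_open_image[OF d] by (rule open_Times)
  from op[unfolded openin_open_eq[OF this]] have "open {z \<in> ?A \<times> ?B. f (?i z) \<in> V}"
    by (rule conjunct1)
  moreover have "snd (prod_chart c d) ` (fst (prod_chart c d) \<inter> f -` V) = {z \<in> ?A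
      \<times> ?B. f (?i z) \<in> V}"
  proof (intro equalityI subsetI)
    fix z assume "z \<in> snd (prod_chart c d) ` (fst (prod_chart c d) \<inter> f -` V)"
    then obtain w where w: "w \<in> fst c \<times> fst d" "f w \<in> V" "z = snd (prod_chart c d) w"
      by (auto simp only: prod_chart_simps)
    obtain x y where "w = (x, y)" by (cases w)
    with w have "x \<in> fst c" "y \<in> fst d" "f (x, y) \<in> V" "z = (snd c x, snd d y)"
      by (simp_all add: prod_chart_simps)
    then show "z \<in> {z \<in> ?A \<times> ?B. f (?i z) \<in> V}"
      using chart_inv_left[OF c] chart_inv_left[OF d] by simp
  next
    fix z assume z: "z \<in> {z \<in> ?A \<times> ?B. f (?i z) \<in> V}"
    then have "z = snd (prod_chart c d) (?i z)"
      by (cases z) (simp add: prod_chart_simps chart_inv_right)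
    moreover have "?i z \<in> fst (prod_chart c d) \<inter> f -` V"
      using z by (cases z) (simp add: prod_chart_simps chart_inv_into)
    ultimately show "z \<in> snd (prod_chart c d) ` (fst (prod_chart c d) \<inter> f -` V)" by (rule
        image_eqI)
  qed
  ultimately show ?thesis by simp
qed

section \<open>Smooth maps: velocities of image curves, and composition\<close>

lemma smooth_manifold_chart: "smooth_manifold M \<Longrightarrow> c \<in> atlas M \<Longrightarrow>
    is_chart (mtop M) c"
  by (simp add: smooth_manifold_def)

lemma smooth_manifold_chart_at:
  assumes "smooth_manifold M" "x \<in> points M"
  obtains c where "c \<in> atlas M" "x \<in> fst c"
  using assms unfolding smooth_manifold_def by blast

lemma smooth_map_continuous: "smooth_map M N f \<Longrightarrow> continuous_map (mtop M) (mtop N) f"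
  by (simp add: smooth_map_def)

lemma smooth_map_chart:
  "smooth_map M N f \<Longrightarrow> c \<in> atlas M \<Longrightarrow> d \<in> atlas N \<Longrightarrow>
    smooth_on (snd c ` (fst c \<inter> f -` fst d)) (snd d \<circ> f \<circ> chart_inv c)"
  by (simp add: smooth_map_def)

lemma smooth_map_has_derivative:
  assumes "smooth_map M N f" "c \<in> atlas M" "d \<in> atlas N" "x \<in> fst c" "f x \<in> fst d"
  shows "((snd d \<circ> f \<circ> chart_inv c) has_derivative
    frechet_derivative (snd d \<circ> f \<circ> chart_inv c) (at (snd c x))) (at (snd c x))"
proof (rule k_smooth_on_has_derivative)
  show "k_smooth_on (Suc 0) (snd c ` (fst c \<inter> f -` fst d)) (snd d \<circ> f \<circ> chart_inv c)"
    using smooth_map_chart[OF assms(1-3)] by (metis smooth_on_def)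
  show "snd c x \<in> snd c ` (fst c \<inter> f -` fst d)" using assms by simp
qed

text \<open>The value depends on the curve only through its position and coordinate velocity at
  \<open>t\<close>, so two curves sharing these data have image curves with equal velocity; the
  comparison arguments for groups exploit this. The left inverse property of the chart is a
  hypothesis of its own so that product charts fit in.\<close>

lemma smooth_map_curve_derivative:
  assumes f: "smooth_map M N f" "c \<in> atlas M" "d \<in> atlas N" "f (\<sigma> t) \<in> fst d"
    and inv: "\<And>x. x \<in> fst c \<Longrightarrow> chart_inv c (snd c x) = x"
    and ev: "eventually (\<lambda>s. \<sigma> s \<in> fst c) (nhds t)"
    and D: "((\<lambda>s. snd c (\<sigma> s)) has_vector_derivative u) (at t)"
  shows "((\<lambda>s. snd d (f (\<sigma> s))) has_vector_derivative
    frechet_derivative (snd d \<circ> f \<circ> chart_inv c) (at (snd c (\<sigma> t))) u) (at t)"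
proof -
  obtain T where T: "open T" "t \<in> T" "\<And>s. s \<in> T \<Longrightarrow> \<sigma> s \<in> fst c"
    using ev unfolding eventually_nhds by metis
  have dg: "((snd d \<circ> f \<circ> chart_inv c) has_derivative
    frechet_derivative (snd d \<circ> f \<circ> chart_inv c) (at (snd c (\<sigma> t)))) (at (snd c
        (\<sigma> t)))"
    by (rule smooth_map_has_derivative[OF f(1-3) T(3)[OF T(2)] f(4)])
  have "((\<lambda>s. (snd d \<circ> f \<circ> chart_inv c) (snd c (\<sigma> s))) has_vector_derivative
    frechet_derivative (snd d \<circ> f \<circ> chart_inv c) (at (snd c (\<sigma> t))) u) (at t)"
    using vector_derivative_diff_chain_within[OF D has_derivative_at_withinI[OF dg]]
    by (simp add: o_def)
  then show ?thesis
    by (rule has_vector_derivative_transform_within_open[OF _ T(1,2)]) (simp add: inv T(3))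
qed

lemma smooth_on_compose:
  fixes g :: "'b::euclidean_model \<Rightarrow> 'c::real_normed_vector"
  shows "open S \<Longrightarrow> smooth_on S f \<Longrightarrow> smooth_on T g \<Longrightarrow> f
      ` S \<subseteq> T \<Longrightarrow> smooth_on S (\<lambda>x. g (f x))"
  unfolding smooth_on_def by (metis k_smooth_on_compose)

lemma smooth_on_cong: "open S \<Longrightarrow> (\<And>x. x \<in> S \<Longrightarrow> f x = g x)
    \<Longrightarrow> smooth_on S f \<Longrightarrow> smooth_on S g"
  unfolding smooth_on_def by (metis k_smooth_on_cong)

lemma smooth_on_subset: "smooth_on S f \<Longrightarrow> T \<subseteq> S \<Longrightarrow> smooth_on T f"
  unfolding smooth_on_def by (metis k_smooth_on_subset)

lemma smooth_on_local:
  assumes "\<And>x. x \<in> S \<Longrightarrow> \<exists>T. open T \<and> x \<in> T \<and> smooth_on T f"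
  shows "smooth_on S f"
  unfolding smooth_on_def
proof (intro allI k_smooth_on_local)
  fix k x assume "x \<in> S"
  from assms[OF this] show "\<exists>T. open T \<and> x \<in> T \<and> k_smooth_on k T f"
    unfolding smooth_on_def by metis
qed

lemma smooth_on_affine_compose:
  assumes "smooth_on S f" "open T" "bounded_linear L" "\<And>x. x \<in> T \<Longrightarrow> a + L x
      \<in> S"
  shows "smooth_on T (\<lambda>x. f (a + L x))"
  unfolding smooth_on_def
proof
  fix k
  have "k_smooth_on k S f" using assms(1) by (simp add: smooth_on_def)
  from k_smooth_on_affine_compose[OF assms(2,3) _ this] assms(4)
  show "k_smooth_on k T (\<lambda>x. f (a + L x))" by blast
qed

text \<open>No single chart of \<open>N\<close> need contain the relevant image of \<open>f\<close>.
  Around each point a chart \<open>e\<close> at the image is inserted, the composite factors through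
  its coordinates on the open set \<open>?T\<close>, and locality of smoothness collects the
  pieces.\<close>

lemma smooth_map_compose_chart:
  fixes N :: "('b, 'f::euclidean_model) manifold"
  assumes c: "open (snd c ` (fst c \<inter> (g \<circ> f) -` fst d))"
      "\<And>e. e \<in> atlas N \<Longrightarrow> open (snd c ` (fst c \<inter> f -` fst e))" "c
          \<in> atlas M" "fst c \<subseteq> points M"
      "\<And>x. x \<in> fst c \<Longrightarrow> chart_inv c (snd c x) = x"
    and N: "smooth_manifold N" and d: "d \<in> atlas K"
    and f: "smooth_map M N f" and g: "smooth_map N K g"
  shows "smooth_on (snd c ` (fst c \<inter> (g \<circ> f) -` fst d)) (snd d \<circ> (g \<circ> f)
      \<circ> chart_inv c)"
proof (rule smooth_on_local)
  fix y assume "y \<in> snd c ` (fst c \<inter> (g \<circ> f) -` fst d)"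
  then obtain x where x: "x \<in> fst c" "g (f x) \<in> fst d" "y = snd c x" by auto
  have "f x \<in> points N"
    using smooth_map_continuous[OF f] x(1) c(4) continuous_map_image_subset_topspace by blast
  then obtain e where e: "e \<in> atlas N" "f x \<in> fst e" using smooth_manifold_chart_at[OF N] by
      metis
  note ce = smooth_manifold_chart[OF N e(1)]
  let ?T = "snd c ` (fst c \<inter> (g \<circ> f) -` fst d) \<inter> snd c ` (fst c \<inter> f -` fst e)"
  have T: "open ?T" using c(1) c(2)[OF e(1)] by (rule open_Int)
  \<comment> \<open>Membership in an intersection of two images gives two preimages; injectivity of
    the chart identifies them.\<close>
  have memT: "\<exists>x. z = snd c x \<and> x \<in> fst c \<and> f x \<in> fst e \<and> g (f x)
      \<in> fst d" if zT: "z \<in> ?T" for z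
  proof -
    obtain x1 where x1: "z = snd c x1" "x1 \<in> fst c \<inter> (g \<circ> f) -` fst d"
      using IntD1[OF zT] by (rule imageE)
    obtain x2 where x2: "z = snd c x2" "x2 \<in> fst c \<inter> f -` fst e"
      using IntD2[OF zT] by (rule imageE)
    have "chart_inv c (snd c x1) = x1" "chart_inv c (snd c x2) = x2"
      using x1(2) x2(2) by (simp_all add: c(5))
    then have "x1 = x2" using x1(1) x2(1) by simp
    then show ?thesis using x1 x2 by auto
  qed
  have "smooth_on ?T (\<lambda>z. (snd d \<circ> g \<circ> chart_inv e) ((snd e \<circ> f \<circ>
      chart_inv c) z))"
  proof (rule smooth_on_compose[OF T _ smooth_map_chart[OF g e(1) d]])
    show "smooth_on ?T (snd e \<circ> f \<circ> chart_inv c)"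
      by (rule smooth_on_subset[OF smooth_map_chart[OF f c(3) e(1)]]) simp
    show "(snd e \<circ> f \<circ> chart_inv c) ` ?T \<subseteq> snd e ` (fst e \<inter> g -` fst d)"
    proof
      fix w assume "w \<in> (snd e \<circ> f \<circ> chart_inv c) ` ?T"
      then obtain z where z: "z \<in> ?T" "w = (snd e \<circ> f \<circ> chart_inv c) z" by (rule imageE)
      obtain x where "z = snd c x" "x \<in> fst c" "f x \<in> fst e" "g (f x) \<in> fst d" using
          memT[OF z(1)] by metis
      then show "w \<in> snd e ` (fst e \<inter> g -` fst d)" using z(2) c(5) by simp
    qed
  qed
  then have "smooth_on ?T (snd d \<circ> (g \<circ> f) \<circ> chart_inv c)"
  proof (rule smooth_on_cong[OF T, rotated])
    fix z assume "z \<in> ?T"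
    from memT[OF this] obtain x where "z = snd c x" "x \<in> fst c" "f x \<in> fst e" by metis
    then show "(snd d \<circ> g \<circ> chart_inv e) ((snd e \<circ> f \<circ> chart_inv c) z) =
        (snd d \<circ> (g \<circ> f) \<circ> chart_inv c) z"
      using c(5) chart_inv_left[OF ce] by simp
  qed
  moreover have "y \<in> ?T" using x e by simp
  ultimately show "\<exists>T. open T \<and> y \<in> T \<and> smooth_on T (snd d \<circ> (g \<circ>
      f) \<circ> chart_inv c)"
    using T by blast
qed

lemma smooth_map_compose:
  fixes N :: "('b, 'f::euclidean_model) manifold"
  assumes M: "\<And>c. c \<in> atlas M \<Longrightarrow> is_chart (mtop M) c" and N: "smooth_manifold N"
    and K: "\<And>d. d \<in> atlas K \<Longrightarrow> is_chart (mtop K) d"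
    and f: "smooth_map M N f" and g: "smooth_map N K g"
  shows "smooth_map M K (g \<circ> f)"
proof -
  have gf: "continuous_map (mtop M) (mtop K) (g \<circ> f)"
    using continuous_map_compose[OF smooth_map_continuous[OF f] smooth_map_continuous[OF g]] .
  have "smooth_on (snd c ` (fst c \<inter> (g \<circ> f) -` fst d)) (snd d \<circ> (g \<circ> f)
      \<circ> chart_inv c)"
    if c: "c \<in> atlas M" and d: "d \<in> atlas K" for c d
    by (rule smooth_map_compose_chart[OF
          open_chart_domain[OF M[OF c] gf is_chart_openin[OF K[OF d]]]
          open_chart_domain[OF M[OF c] smooth_map_continuous[OF f] is_chart_openin[OF
              smooth_manifold_chart[OF N]]]
          c is_chart_subset[OF M[OF c]] chart_inv_left[OF M[OF c]] N d f g])
  with gf show ?thesis by (simp add: smooth_map_def)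
qed

lemma is_chart_model: "c \<in> atlas model_manifold \<Longrightarrow> is_chart (mtop model_manifold) c"
  by (simp add: model_manifold_def is_chart_def)

lemma smooth_map_from_model_iff:
  "smooth_map model_manifold N \<gamma> \<longleftrightarrow> continuous_map euclidean (mtop N)
      \<gamma> \<and>
    (\<forall>d\<in>atlas N. smooth_on (\<gamma> -` fst d) (\<lambda>t. snd d (\<gamma> t)))"
  by (simp add: smooth_map_def model_manifold_def o_def)

section \<open>Curves with constant left logarithmic derivative\<close>

locale Lie_group = group G for G :: "('g, 'e::euclidean_model) lie_grp" (structure) +
  assumes lie_group: "lie_group G"
begin

lemma mult_inv_cancel:
  assumes "x \<in> carrier G" "y \<in> carrier G"
  shows "x \<otimes> (inv x \<otimes> y) = y" "inv x \<otimes> (x \<otimes> y) = y"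
  using assms by (simp_all flip: m_assoc)

lemma manifold: "smooth_manifold (mfd G)"
  and points_eq: "points (mfd G) = carrier G"
  and smooth_mult: "smooth_map (product_manifold (mfd G) (mfd G)) (mfd G) (\<lambda>(x, y). x
      \<otimes> y)"
  and smooth_inv: "smooth_map (mfd G) (mfd G) (\<lambda>x. inv x)"
  using lie_group unfolding lie_group_def by blast+

lemma chart: "c \<in> atlas (mfd G) \<Longrightarrow> is_chart (mtop (mfd G)) c"
  using smooth_manifold_chart[OF manifold] .

lemma chart_carrier: "c \<in> atlas (mfd G) \<Longrightarrow> x \<in> fst c \<Longrightarrow> x
    \<in> carrier G"
  using is_chart_subset[OF chart] points_eq by blast

lemma obtain_chart: "x \<in> carrier G \<Longrightarrow> (\<And>c. c \<in> atlas (mfd G)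
    \<Longrightarrow> x \<in> fst c \<Longrightarrow> thesis) \<Longrightarrow> thesis"
  using smooth_manifold_chart_at[OF manifold] points_eq by metis

lemma continuous_map_mult:
  assumes "continuous_map X (mtop (mfd G)) f" "continuous_map X (mtop (mfd G)) g"
  shows "continuous_map X (mtop (mfd G)) (\<lambda>x. f x \<otimes> g x)"
proof -
  have m: "continuous_map (prod_topology (mtop (mfd G)) (mtop (mfd G))) (mtop (mfd G)) (\<lambda>(x,
      y). x \<otimes> y)"
    using smooth_map_continuous[OF smooth_mult] by (simp add: product_manifold_def)
  have "continuous_map X (prod_topology (mtop (mfd G)) (mtop (mfd G))) (\<lambda>x. (f x, g x))"
    using assms by (simp add: continuous_map_pairwise o_def)
  from continuous_map_compose[OF this m] show ?thesis by (simp add: o_def)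
qed

lemma continuous_map_inv:
  assumes "continuous_map X (mtop (mfd G)) f"
  shows "continuous_map X (mtop (mfd G)) (\<lambda>x. inv (f x))"
  using continuous_map_compose[OF assms smooth_map_continuous[OF smooth_inv]] by (simp add: o_def)

lemma continuous_map_mult_const:
  assumes "g \<in> carrier G" "continuous_map X (mtop (mfd G)) f"
  shows "continuous_map X (mtop (mfd G)) (\<lambda>x. g \<otimes> f x)"
  using assms by (intro continuous_map_mult) (simp_all add: points_eq)

lemma smooth_mult_chart:
  assumes "c \<in> atlas (mfd G)" "d \<in> atlas (mfd G)" "e \<in> atlas (mfd G)"
  defines "S \<equiv> snd (prod_chart c d) ` (fst (prod_chart c d) \<inter> (\<lambda>(x, y). x
      \<otimes> y) -` fst e)"
  shows "open S" "smooth_on S (snd e \<circ> (\<lambda>(x, y). x \<otimes> y) \<circ> chart_inv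
      (prod_chart c d))"
proof -
  have "continuous_map (prod_topology (mtop (mfd G)) (mtop (mfd G))) (mtop (mfd G)) (\<lambda>(x,
      y). x \<otimes> y)"
    using smooth_map_continuous[OF smooth_mult] by (simp add: product_manifold_def)
  then show "open S" unfolding S_def
    by (rule open_prod_chart_domain[OF chart[OF assms(1)] chart[OF assms(2)]])
      (rule is_chart_openin[OF chart[OF assms(3)]])
  show "smooth_on S (snd e \<circ> (\<lambda>(x, y). x \<otimes> y) \<circ> chart_inv (prod_chart c d))"
    unfolding S_def by (rule smooth_map_chart[OF smooth_mult prod_chart_in_atlas[OF assms(1,2)]
        assms(3)])
qed

text \<open>In coordinates this is multiplication restricted to the affine slice whose first
  coordinate is that of \<open>g\<close>, so smoothness follows from that of multiplication by an
  affine substitution.\<close>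

lemma smooth_left_translation:
  assumes g: "g \<in> carrier G"
  shows "smooth_map (mfd G) (mfd G) (\<lambda>x. g \<otimes> x)"
  unfolding smooth_map_def
proof (intro conjI ballI)
  show cont: "continuous_map (mtop (mfd G)) (mtop (mfd G)) (\<lambda>x. g \<otimes> x)"
    by (rule continuous_map_mult_const[OF g]) simp
  fix d e assume d: "d \<in> atlas (mfd G)" and e: "e \<in> atlas (mfd G)"
  obtain c where c: "c \<in> atlas (mfd G)" "g \<in> fst c" using obtain_chart[OF g] .
  let ?D = "snd d ` (fst d \<inter> (\<lambda>x. g \<otimes> x) -` fst e)"
  have op: "open ?D"
    by (rule open_chart_domain[OF chart[OF d] cont is_chart_openin[OF chart[OF e]]])
  have "smooth_on ?D (\<lambda>y. (snd e \<circ> (\<lambda>(x, y). x \<otimes> y) \<circ> chart_inv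
      (prod_chart c d)) ((snd c g, 0) + (0, y)))"
  proof (rule smooth_on_affine_compose[OF smooth_mult_chart(2)[OF c(1) d e] op])
    show "bounded_linear (\<lambda>y. (0, y))" by (intro bounded_linear_intros)
    fix y assume "y \<in> ?D"
    then obtain x where x: "y = snd d x" "x \<in> fst d \<inter> (\<lambda>x. g \<otimes> x) -` fst
        e" by (rule imageE)
    have "(snd c g, 0) + (0, y) = snd (prod_chart c d) (g, x)" by (simp add: x prod_chart_simps)
    moreover have "(g, x) \<in> fst (prod_chart c d) \<inter> (\<lambda>(x, y). x \<otimes> y) -` fst e"
      using x c by (simp add: prod_chart_simps)
    ultimately show "(snd c g, 0) + (0, y) \<in> snd (prod_chart c d) ` (fst (prod_chart c d)
        \<inter> (\<lambda>(x, y). x \<otimes> y) -` fst e)"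
      by (rule image_eqI)
  qed
  then show "smooth_on ?D (snd e \<circ> (\<lambda>x. g \<otimes> x) \<circ> chart_inv d)"
  proof (rule smooth_on_cong[OF op, rotated])
    fix y assume "y \<in> ?D"
    then have "y \<in> snd d ` fst d" by blast
    then show "(snd e \<circ> (\<lambda>(x, y). x \<otimes> y) \<circ> chart_inv (prod_chart c d))
        ((snd c g, 0) + (0, y))
      = (snd e \<circ> (\<lambda>x. g \<otimes> x) \<circ> chart_inv d) y"
      using c by (simp add: prod_chart_inv[OF chart[OF c(1)] chart[OF d]] chart_inv_left[OF chart[OF
          c(1)]])
  qed
qed

lemma smooth_right_translation:
  assumes g: "g \<in> carrier G"
  shows "smooth_map (mfd G) (mfd G) (\<lambda>x. x \<otimes> g)"
  unfolding smooth_map_def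
proof (intro conjI ballI)
  show cont: "continuous_map (mtop (mfd G)) (mtop (mfd G)) (\<lambda>x. x \<otimes> g)"
    using g by (intro continuous_map_mult) (simp_all add: points_eq)
  fix d e assume d: "d \<in> atlas (mfd G)" and e: "e \<in> atlas (mfd G)"
  obtain c where c: "c \<in> atlas (mfd G)" "g \<in> fst c" using obtain_chart[OF g] .
  let ?D = "snd d ` (fst d \<inter> (\<lambda>x. x \<otimes> g) -` fst e)"
  have op: "open ?D"
    by (rule open_chart_domain[OF chart[OF d] cont is_chart_openin[OF chart[OF e]]])
  have "smooth_on ?D (\<lambda>y. (snd e \<circ> (\<lambda>(x, y). x \<otimes> y) \<circ> chart_inv
      (prod_chart d c)) ((0, snd c g) + (y, 0)))"
  proof (rule smooth_on_affine_compose[OF smooth_mult_chart(2)[OF d c(1) e] op])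
    show "bounded_linear (\<lambda>y. (y, 0))" by (intro bounded_linear_intros)
    fix y assume "y \<in> ?D"
    then obtain x where x: "y = snd d x" "x \<in> fst d \<inter> (\<lambda>x. x \<otimes> g) -` fst
        e" by (rule imageE)
    have "(0, snd c g) + (y, 0) = snd (prod_chart d c) (x, g)" by (simp add: x prod_chart_simps)
    moreover have "(x, g) \<in> fst (prod_chart d c) \<inter> (\<lambda>(x, y). x \<otimes> y) -` fst e"
      using x c by (simp add: prod_chart_simps)
    ultimately show "(0, snd c g) + (y, 0) \<in> snd (prod_chart d c) ` (fst (prod_chart d c)
        \<inter> (\<lambda>(x, y). x \<otimes> y) -` fst e)"
      by (rule image_eqI)
  qed
  then show "smooth_on ?D (snd e \<circ> (\<lambda>x. x \<otimes> g) \<circ> chart_inv d)"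
  proof (rule smooth_on_cong[OF op, rotated])
    fix y assume "y \<in> ?D"
    then have "y \<in> snd d ` fst d" by blast
    then show "(snd e \<circ> (\<lambda>(x, y). x \<otimes> y) \<circ> chart_inv (prod_chart d c))
        ((0, snd c g) + (y, 0))
      = (snd e \<circ> (\<lambda>x. x \<otimes> g) \<circ> chart_inv d) y"
      using c by (simp add: prod_chart_inv[OF chart[OF d] chart[OF c(1)]] chart_inv_left[OF chart[OF
          c(1)]])
  qed
qed

lemma smooth_two_sided_translation:
  assumes "g \<in> carrier G" "h \<in> carrier G"
  shows "smooth_map (mfd G) (mfd G) (\<lambda>x. g \<otimes> x \<otimes> h)"
  using smooth_map_compose[OF chart manifold chart smooth_left_translation[OF assms(1)]
      smooth_right_translation[OF assms(2)]]
  by (simp add: o_def)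

text \<open>Classically, multiplication differentiates at the unit to addition and inversion to
  negation, so the velocity is \<open>w - w\<close>. The argument below obtains zero without either
  formula.\<close>

lemma quotient_curve_derivative:
  assumes c: "c \<in> atlas (mfd G)" and ab: "a t = \<one>" "b t = \<one>"
    and a: "eventually (\<lambda>s. a s \<in> fst c) (nhds t)" "((\<lambda>s. snd c (a s))
        has_vector_derivative w) (at t)"
    and b: "eventually (\<lambda>s. b s \<in> fst c) (nhds t)" "((\<lambda>s. snd c (b s))
        has_vector_derivative w) (at t)"
    and inv_ev: "eventually (\<lambda>s. inv (a s) \<in> fst c) (nhds t)" "eventually (\<lambda>s.
        inv (b s) \<in> fst c) (nhds t)"
  shows "((\<lambda>s. snd c (a s \<otimes> inv (b s))) has_vector_derivative 0) (at t)"
proof -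
  have one: "\<one> \<in> fst c" using eventually_nhds_x_imp_x[OF a(1)] ab by simp
  let ?Di = "frechet_derivative (snd c \<circ> (\<lambda>x. inv x) \<circ> chart_inv c) (at (snd c
      \<one>)) w"
  let ?Dm = "frechet_derivative (snd c \<circ> (\<lambda>(x, y). x \<otimes> y) \<circ> chart_inv
      (prod_chart c c))
    (at (snd (prod_chart c c) (\<one>, \<one>))) (w, ?Di)"
  have key: "((\<lambda>s. snd c (a s \<otimes> inv (b s))) has_vector_derivative ?Dm) (at t)"
    if b': "b t = \<one>" "eventually (\<lambda>s. b s \<in> fst c) (nhds t)"
      "((\<lambda>s. snd c (b s)) has_vector_derivative w) (at t)" "eventually (\<lambda>s. inv (b
          s) \<in> fst c) (nhds t)" for b
  proof -
    have 1: "((\<lambda>s. snd c (inv (b s))) has_vector_derivative ?Di) (at t)"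
      using smooth_map_curve_derivative[OF smooth_inv c c, where \<sigma> = b and t = t, OF _
          chart_inv_left[OF chart[OF c]] b'(2,3)]
      by (simp add: b'(1) one)
    have "((\<lambda>s. snd c ((\<lambda>(x, y). x \<otimes> y) (a s, inv (b s)))) has_vector_derivative
      frechet_derivative (snd c \<circ> (\<lambda>(x, y). x \<otimes> y) \<circ> chart_inv
          (prod_chart c c))
        (at (snd (prod_chart c c) (a t, inv (b t)))) (w, ?Di)) (at t)"
    proof (rule smooth_map_curve_derivative[OF smooth_mult prod_chart_in_atlas[OF c c] c, where
        \<sigma> = "\<lambda>s. (a s, inv (b s))"])
      show "(\<lambda>(x, y). x \<otimes> y) (a t, inv (b t)) \<in> fst c" by (simp add: ab b'(1) one)
      show "chart_inv (prod_chart c c) (snd (prod_chart c c) x) = x" if "x \<in> fst (prod_chart c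
          c)" for x
        using that by (rule prod_chart_inv_left[OF chart[OF c] chart[OF c]])
    next
      show "eventually (\<lambda>s. (a s, inv (b s)) \<in> fst (prod_chart c c)) (nhds t)"
        using eventually_conj[OF a(1) b'(4)] by (simp add: prod_chart_simps)
      show "((\<lambda>s. snd (prod_chart c c) (a s, inv (b s))) has_vector_derivative (w, ?Di)) (at t)"
        using has_vector_derivative_Pair[OF a(2) 1] by (simp add: prod_chart_simps)
    qed
    then show ?thesis by (simp add: ab b'(1))
  qed
  \<comment> \<open>The derivative \<open>?Dm\<close> does not depend on \<open>b\<close>; for \<open>b = a\<close> the quotient is constant.\<close>
  have "((\<lambda>s. snd c (a s \<otimes> inv (a s))) has_vector_derivative ?Dm) (at t)"
    by (rule key[OF ab(1) a inv_ev(1)])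
  moreover have "((\<lambda>s. snd c (a s \<otimes> inv (a s))) has_vector_derivative 0) (at t)"
  proof -
    obtain T where T: "open T" "t \<in> T" "\<And>s. s \<in> T \<Longrightarrow> a s \<in> fst c"
      using a(1) unfolding eventually_nhds by metis
    show ?thesis
      by (rule has_vector_derivative_transform_within_open[OF has_vector_derivative_const T(1,2), of
          "snd c \<one>"])
        (simp add: r_inv chart_carrier[OF c T(3)])
  qed
  ultimately have "?Dm = 0" by (rule vector_derivative_unique_at)
  with key[OF ab(2) b inv_ev(2)] show ?thesis by simp
qed

text \<open>A curve with constant left logarithmic derivative; \<open>w\<close> is the coordinate
    vector of that
  derivative in a chart \<open>c\<close> around the unit.\<close>

definition left_invariant_curve :: "('g, 'e) chart \<Rightarrow> 'e \<Rightarrow> real set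
    \<Rightarrow> (real \<Rightarrow> 'g) \<Rightarrow> bool" where
  "left_invariant_curve c w J \<alpha> \<longleftrightarrow> continuous_map (top_of_set J) (mtop
      (mfd G)) \<alpha> \<and>
     (\<forall>t\<in>J. ((\<lambda>s. snd c (inv (\<alpha> t) \<otimes> \<alpha> s))
         has_vector_derivative w) (at t))"

lemma continuous_curve_carrier:
  "continuous_map (top_of_set J) (mtop (mfd G)) \<alpha> \<Longrightarrow> t \<in> J
      \<Longrightarrow> \<alpha> t \<in> carrier G"
  using continuous_map_image_subset_topspace points_eq by fastforce

lemma continuous_curve_open:
  assumes "open J" "continuous_map (top_of_set J) (mtop (mfd G)) \<alpha>" "c \<in> atlas (mfd G)"
  shows "open {s \<in> J. \<alpha> s \<in> fst c}"
  using openin_continuous_map_preimage[OF assms(2) is_chart_openin[OF chart[OF assms(3)]]]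
    openin_open_eq[OF assms(1)] by simp

lemma continuous_curve_eventually:
  assumes "open J" "continuous_map (top_of_set J) (mtop (mfd G)) \<alpha>" "c \<in> atlas (mfd G)"
      "t \<in> J" "\<alpha> t \<in> fst c"
  shows "eventually (\<lambda>s. \<alpha> s \<in> fst c) (nhds t)"
  using eventually_nhds_in_open[OF continuous_curve_open[OF assms(1-3)], of t] assms(4,5)
  by (auto elim: eventually_mono)

lemma left_invariant_curve_unique:
  assumes c: "c \<in> atlas (mfd G)" "\<one> \<in> fst c" and J: "open J" "connected J"
    and A: "left_invariant_curve c w J \<alpha>" and B: "left_invariant_curve c w J \<beta>"
    and t0: "t0 \<in> J" "\<alpha> t0 = \<beta> t0" and t: "t \<in> J"
  shows "\<alpha> t = \<beta> t"
proof -
  have Ac: "continuous_map (top_of_set J) (mtop (mfd G)) \<alpha>" and Bc: "continuous_map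
      (top_of_set J) (mtop (mfd G)) \<beta>"
    and Ad: "\<And>t. t \<in> J \<Longrightarrow> ((\<lambda>s. snd c (inv (\<alpha> t) \<otimes>
        \<alpha> s)) has_vector_derivative w) (at t)"
    and Bd: "\<And>t. t \<in> J \<Longrightarrow> ((\<lambda>s. snd c (inv (\<beta> t) \<otimes>
        \<beta> s)) has_vector_derivative w) (at t)"
    using A B by (simp_all add: left_invariant_curve_def)
  note carA = continuous_curve_carrier[OF Ac] and carB = continuous_curve_carrier[OF Bc]
  define \<eta> where "\<eta> s = \<alpha> s \<otimes> inv (\<beta> s)" for s
  have \<eta>c: "continuous_map (top_of_set J) (mtop (mfd G)) \<eta>"
    unfolding \<eta>_def by (intro continuous_map_mult continuous_map_inv Ac Bc)
  have D0: "((\<lambda>s. snd d (\<eta> s)) has_vector_derivative 0) (at u)"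
    if d: "d \<in> atlas (mfd G)" and u: "u \<in> J" "\<eta> u \<in> fst d" for d u
  proof -
    \<comment> \<open>Left translation moves both curves to the unit at time \<open>u\<close>, where
      each has coordinate velocity \<open>w\<close> in the fixed chart \<open>c\<close>.\<close>
    define a where "a s = inv (\<alpha> u) \<otimes> \<alpha> s" for s
    define b where "b s = inv (\<beta> u) \<otimes> \<beta> s" for s
    have ac: "continuous_map (top_of_set J) (mtop (mfd G)) a" and bc: "continuous_map (top_of_set J)
        (mtop (mfd G)) b"
      unfolding a_def b_def using carA carB u by (auto intro!: continuous_map_mult_const Ac Bc)
    have ab1: "a u = \<one>" "b u = \<one>" using carA carB u by (simp_all add: a_def b_def)
    have zero: "((\<lambda>s. snd c (a s \<otimes> inv (b s))) has_vector_derivative 0) (at u)"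
    proof (rule quotient_curve_derivative[where a = a and b = b and t = u, OF c(1) ab1])
      show "((\<lambda>s. snd c (a s)) has_vector_derivative w) (at u)" using Ad u(1) by (simp add:
          a_def)
      show "((\<lambda>s. snd c (b s)) has_vector_derivative w) (at u)" using Bd u(1) by (simp add:
          b_def)
    qed (use ab1 c in \<open>intro continuous_curve_eventually[OF J(1) _ c(1) u(1)] ac bc
        continuous_map_inv; simp\<close>)+
    have sand: "smooth_map (mfd G) (mfd G) (\<lambda>x. \<alpha> u \<otimes> x \<otimes> inv
        (\<beta> u))"
      using carA carB u by (intro smooth_two_sided_translation) auto
    \<comment> \<open>The original quotient is a fixed two-sided translate of the quotient of the
      normalized curves, so its derivative in the chart \<open>d\<close> is a linear image of their
      zero derivative.\<close>
    have eq: "\<alpha> u \<otimes> (a s \<otimes> inv (b s)) \<otimes> inv (\<beta> u) = \<eta> s"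
        if "s \<in> J" for s
    proof -
      have car: "\<alpha> u \<in> carrier G" "\<beta> u \<in> carrier G" "\<alpha> s \<in> carrier
          G" "\<beta> s \<in> carrier G"
        using carA carB u that by auto
      then show ?thesis
        by (simp add: a_def b_def \<eta>_def inv_mult_group m_assoc mult_inv_cancel)
    qed
    have "((\<lambda>s. snd d (\<alpha> u \<otimes> (a s \<otimes> inv (b s)) \<otimes> inv (\<beta>
        u))) has_vector_derivative
      frechet_derivative (snd d \<circ> (\<lambda>x. \<alpha> u \<otimes> x \<otimes> inv (\<beta>
          u)) \<circ> chart_inv c) (at (snd c (a u \<otimes> inv (b u)))) 0) (at u)"
    proof (rule smooth_map_curve_derivative[OF sand c(1) d, where \<sigma> = "\<lambda>s. a s
        \<otimes> inv (b s)"])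
      show "\<alpha> u \<otimes> (a u \<otimes> inv (b u)) \<otimes> inv (\<beta> u) \<in> fst d"
          using eq[OF u(1)] u(2) by simp
      show "chart_inv c (snd c x) = x" if "x \<in> fst c" for x using chart_inv_left[OF chart[OF
          c(1)] that] .
      show "\<forall>\<^sub>F s in nhds u. a s \<otimes> inv (b s) \<in> fst c"
        by (rule continuous_curve_eventually[OF J(1) _ c(1) u(1)])
          (auto intro!: continuous_map_mult continuous_map_inv ac bc simp: ab1 c)
    qed (rule zero)
    moreover have "frechet_derivative (snd d \<circ> (\<lambda>x. \<alpha> u \<otimes> x \<otimes>
        inv (\<beta> u)) \<circ> chart_inv c) (at (snd c (a u \<otimes> inv (b u)))) 0 = 0"
    proof (rule linear_0[OF has_derivative_linear[OF smooth_map_has_derivative[OF sand c(1) d]]])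
      show "a u \<otimes> inv (b u) \<in> fst c" using c(2) by (simp add: ab1)
      show "\<alpha> u \<otimes> (a u \<otimes> inv (b u)) \<otimes> inv (\<beta> u) \<in> fst d"
          using eq[OF u(1)] u(2) by simp
    qed
    ultimately have "((\<lambda>s. snd d (\<alpha> u \<otimes> (a s \<otimes> inv (b s)) \<otimes>
        inv (\<beta> u))) has_vector_derivative 0) (at u)" by simp
    then show ?thesis
      by (rule has_vector_derivative_transform_within_open[OF _ J(1) u(1)]) (simp add: eq)
  qed
  \<comment> \<open>Coordinates see \<open>\<eta>\<close> only while it stays in one chart.
    Constancy is obtained on small balls, carried from coordinates to the group by injectivity of
    the chart, and spread over \<open>J\<close> by connectedness.\<close>
  have "\<eta> constant_on J"
  proof (rule locally_constant_imp_constant[OF J(2)])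
    fix u assume u: "u \<in> J"
    obtain d where d: "d \<in> atlas (mfd G)" "\<eta> u \<in> fst d"
      using obtain_chart[OF continuous_curve_carrier[OF \<eta>c u]] .
    have op: "open {s \<in> J. \<eta> s \<in> fst d}" by (rule continuous_curve_open[OF J(1) \<eta>c
        d(1)])
    moreover have "u \<in> {s \<in> J. \<eta> s \<in> fst d}" using u d by simp
    ultimately obtain e where e: "e > 0" "ball u e \<subseteq> {s \<in> J. \<eta> s \<in> fst d}"
      using openE by blast
    have "\<exists>k. \<forall>s\<in>ball u e. snd d (\<eta> s) = k"
    proof (rule has_vector_derivative_zero_constant[OF convex_ball, of u e "\<lambda>s. snd d
        (\<eta> s)"])
      fix s assume "s \<in> ball u e"
      then have "s \<in> J" "\<eta> s \<in> fst d" using e(2) by blast+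
      then show "((\<lambda>s. snd d (\<eta> s)) has_vector_derivative 0) (at s within ball u e)"
        by (rule has_vector_derivative_at_within[OF D0[OF d(1)]])
    qed blast
    then obtain k where k: "\<And>s. s \<in> ball u e \<Longrightarrow> snd d (\<eta> s) = k" by blast
    have "\<eta> s = \<eta> u" if s: "s \<in> ball u e" for s
    proof (rule inj_onD[OF is_chart_inj[OF chart[OF d(1)]]])
      show "snd d (\<eta> s) = snd d (\<eta> u)" using k[OF s] k[of u] e(1) by simp
      show "\<eta> s \<in> fst d" using s e(2) by blast
    qed (rule d(2))
    moreover have "openin (top_of_set J) (ball u e)"
      using e(2) by (intro open_openin_trans[OF J(1) open_ball]) blast
    ultimately show "\<exists>T. openin (top_of_set J) T \<and> u \<in> T \<and> (\<forall>x\<in>T.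
        \<eta> x = \<eta> u)"
      using e(1) centre_in_ball by blast
  qed
  then have "\<eta> t = \<eta> t0" using t t0(1) unfolding constant_on_def by metis
  also have "\<eta> t0 = \<one>" using t0 carB by (simp add: \<eta>_def)
  finally have "\<alpha> t = inv (inv (\<beta> t))"
    unfolding \<eta>_def using carA[OF t] carB[OF t] inv_equality[of "\<alpha> t" "inv (\<beta> t)"]
        by simp
  then show ?thesis using carB[OF t] by simp
qed

end

section \<open>Existence and uniqueness of one-parameter subgroups\<close>

text \<open>The value at \<open>t\<close> is a power of \<open>\<gamma>\<close> at a fraction of
  \<open>t\<close> small enough to lie in the domain. Two admissible denominators are compared
  through their product, so the choice does not affect the value.\<close>

lemma (in group) local_hom_extends:
  fixes \<gamma> :: "real \<Rightarrow> 'a"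
  assumes d: "d > 0" and car: "\<And>t. \<bar>t\<bar> < d \<Longrightarrow> \<gamma> t \<in> carrier G"
    and hom: "\<And>s t. \<bar>s\<bar> < d \<Longrightarrow> \<bar>t\<bar> < d \<Longrightarrow>
        \<bar>s + t\<bar> < d \<Longrightarrow> \<gamma> (s + t) = \<gamma> s \<otimes> \<gamma> t"
  obtains \<Gamma> where "\<And>t. \<Gamma> t \<in> carrier G" "\<And>s t. \<Gamma> (s + t) =
      \<Gamma> s \<otimes> \<Gamma> t"
    "\<And>t. \<bar>t\<bar> < d \<Longrightarrow> \<Gamma> t = \<gamma> t"
proof -
  have pow: "\<gamma> (real k * x) = \<gamma> x [^] k" if "\<bar>real k * x\<bar> < d"
      "\<bar>x\<bar> < d" for k x
    using that(1)
  proof (induction k)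
    case 0
    have "\<gamma> 0 \<otimes> \<gamma> 0 = \<gamma> 0" using hom[of 0 0] d by simp
    then show ?case using car[of 0] d by (simp add: l_cancel_one)
  next
    case (Suc k)
    have "\<bar>real k * x\<bar> \<le> \<bar>real (Suc k) * x\<bar>" by (simp add: abs_mult
        mult_right_mono)
    then have k: "\<bar>real k * x\<bar> < d" using Suc.prems by linarith
    have eq: "real (Suc k) * x = real k * x + x" by (simp add: algebra_simps)
    show ?case using Suc.IH[OF k] hom[OF k that(2)] Suc.prems unfolding eq by simp
  qed
  define ok where "ok n t \<longleftrightarrow> n > 0 \<and> \<bar>t\<bar> < real n * d" for n ::
      nat and t :: real
  have okD: "\<bar>t / real n\<bar> < d" if "ok n t" for n t
    using that by (simp add: ok_def abs_divide divide_less_eq mult.commute)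
  have ex: "\<exists>n. ok n t" for t
  proof -
    obtain n :: nat where "\<bar>t\<bar> / d < real n" using reals_Archimedean2 by blast
    moreover have "0 \<le> \<bar>t\<bar> / d" using d by simp
    ultimately have "n > 0" by (cases n) auto
    then show ?thesis using \<open>\<bar>t\<bar> / d < real n\<close> d by (auto simp: ok_def
        divide_less_eq)
  qed
  have ok_mult: "ok (m * n) t" if "ok n t" "m > 0" for m n t
  proof -
    have "1 * (real n * d) \<le> real m * (real n * d)" using that d by (intro mult_right_mono) auto
    moreover have "n > 0" "\<bar>t\<bar> < real n * d" using that(1) by (simp_all add: ok_def)
    ultimately have "\<bar>t\<bar> < real (m * n) * d" by (simp only: of_nat_mult mult.assoc mult_1_left)
    then show ?thesis using \<open>n > 0\<close> that(2) by (simp add: ok_def)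
  qed
  \<comment> \<open>Splitting each step of length \<open>t / n\<close> into \<open>m\<close> equal
    steps turns one factor into an \<open>m\<close>-th power, by the local power rule.\<close>
  have refine: "\<gamma> (t / real n) [^] n = \<gamma> (t / real (m * n)) [^] (m * n)" if "ok n t"
      "m > 0" for m n t
  proof -
    have "real m * (t / real (m * n)) = t / real n" using that by (simp add: ok_def)
    then have "\<gamma> (t / real n) = \<gamma> (t / real (m * n)) [^] m"
      using pow[of m "t / real (m * n)"] okD[OF that(1)] okD[OF ok_mult[OF that]] by simp
    then show ?thesis using car[OF okD[OF ok_mult[OF that]]] by (simp add: nat_pow_pow)
  qed
  define \<Gamma> where "\<Gamma> t = \<gamma> (t / real (SOME n. ok n t)) [^] (SOME n. ok n t)" for t
  have \<Gamma>: "\<Gamma> t = \<gamma> (t / real n) [^] n" if n: "ok n t" for t n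
  proof -
    have m: "ok (SOME n. ok n t) t" using ex by (rule someI_ex)
    show ?thesis
      using refine[OF n, of "SOME n. ok n t"] refine[OF m, of n] n m
      unfolding \<Gamma>_def by (simp add: ok_def mult.commute)
  qed
  show thesis
  proof (rule that)
    fix t
    obtain n where n: "ok n t" using ex by blast
    show "\<Gamma> t \<in> carrier G" unfolding \<Gamma>[OF n] using car[OF okD[OF n]] by simp
  next
    fix t assume "\<bar>t\<bar> < d"
    then have "ok 1 t" by (simp add: ok_def)
    from \<Gamma>[OF this] show "\<Gamma> t = \<gamma> t" using car[OF \<open>\<bar>t\<bar> <
        d\<close>] by simp
  next
    fix s t
    \<comment> \<open>The sum of absolute values dominates \<open>s\<close>, \<open>t\<close> and
      \<open>s + t\<close>, so one denominator serves all three.\<close>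
    obtain n where n: "ok n (\<bar>s\<bar> + \<bar>t\<bar>)" using ex by blast
    then have s: "ok n s" and t: "ok n t" and st: "ok n (s + t)" by (auto simp: ok_def)
    note S = okD[OF s] and T = okD[OF t]
    have ST: "\<bar>s / real n + t / real n\<bar> < d" using okD[OF st] by (simp add: add_divide_distrib)
    \<comment> \<open>The two factors commute because addition of reals does; this is what allows
      the power of the product to split.\<close>
    have "\<gamma> (s / real n) \<otimes> \<gamma> (t / real n) = \<gamma> (t / real n) \<otimes>
        \<gamma> (s / real n)"
      using hom[OF S T ST] hom[OF T S] ST by (simp add: add.commute)
    then show "\<Gamma> (s + t) = \<Gamma> s \<otimes> \<Gamma> t"
      unfolding \<Gamma>[OF s] \<Gamma>[OF t] \<Gamma>[OF st] add_divide_distrib hom[OF S T ST]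
      by (rule pow_mult_distrib) (rule car[OF S], rule car[OF T])
  qed
qed

context Lie_group
begin

lemma left_invariant_curve_subset:
  "left_invariant_curve c w J \<alpha> \<Longrightarrow> I \<subseteq> J \<Longrightarrow>
      left_invariant_curve c w I \<alpha>"
  unfolding left_invariant_curve_def
  by (metis (no_types) continuous_map_from_subtopology_mono subset_iff)

text \<open>The factor \<open>g\<close> cancels in the quotient of two values of the curve: the
  logarithmic derivative is left invariant.\<close>

lemma left_invariant_curve_translate:
  assumes g: "g \<in> carrier G" and A: "left_invariant_curve c w J \<alpha>" and J: "open J"
  shows "left_invariant_curve c w J (\<lambda>t. g \<otimes> \<alpha> t)"
  unfolding left_invariant_curve_def
proof (intro conjI ballI)
  have Ac: "continuous_map (top_of_set J) (mtop (mfd G)) \<alpha>" using A by (simp add: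
      left_invariant_curve_def)
  show "continuous_map (top_of_set J) (mtop (mfd G)) (\<lambda>t. g \<otimes> \<alpha> t)"
    using g Ac by (rule continuous_map_mult_const)
  fix t assume t: "t \<in> J"
  have "((\<lambda>s. snd c (inv (\<alpha> t) \<otimes> \<alpha> s)) has_vector_derivative w) (at t)"
    using A t by (simp add: left_invariant_curve_def)
  then show "((\<lambda>s. snd c (inv (g \<otimes> \<alpha> t) \<otimes> (g \<otimes> \<alpha> s)))
      has_vector_derivative w) (at t)"
    by (rule has_vector_derivative_transform_within_open[OF _ J t])
      (simp add: g continuous_curve_carrier[OF Ac] t inv_mult_group m_assoc mult_inv_cancel)
qed

text \<open>The condition does not involve time explicitly. Shifting the argument and translating by
  a group element thus produce curves with the same vector, and their equality is the homomorphism
  property.\<close>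

lemma left_invariant_curve_shift:
  assumes A: "left_invariant_curve c w J \<alpha>"
  shows "left_invariant_curve c w {t. a + t \<in> J} (\<lambda>t. \<alpha> (a + t))"
  unfolding left_invariant_curve_def
proof (intro conjI ballI)
  have Ac: "continuous_map (top_of_set J) (mtop (mfd G)) \<alpha>" using A by (simp add:
      left_invariant_curve_def)
  have "continuous_map (top_of_set {t. a + t \<in> J}) (top_of_set J) (\<lambda>t. a + t)"
    by (auto intro!: continuous_intros)
  from continuous_map_compose[OF this Ac]
  show "continuous_map (top_of_set {t. a + t \<in> J}) (mtop (mfd G)) (\<lambda>t. \<alpha> (a +
      t))" by (simp add: o_def)
  fix t assume "t \<in> {t. a + t \<in> J}"
  then have D: "((\<lambda>s. snd c (inv (\<alpha> (a + t)) \<otimes> \<alpha> s))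
      has_vector_derivative w) (at (a + t))"
    using A by (simp add: left_invariant_curve_def)
  have "((\<lambda>s. a + s) has_vector_derivative 1) (at t)" by (auto intro!: derivative_eq_intros)
  from vector_diff_chain_at[OF this D]
  show "((\<lambda>s. snd c (inv (\<alpha> (a + t)) \<otimes> \<alpha> (a + s)))
      has_vector_derivative w) (at t)" by (simp add: o_def)
qed

text \<open>The curve is a local integral curve through the unit of the left-invariant vector field
  with value \<open>w\<close> there. What remains after solving the equation is to convert it into
  the condition on the logarithmic derivative.\<close>

lemma left_invariant_curve_exists:
  assumes c: "c \<in> atlas (mfd G)" "\<one> \<in> fst c"
  obtains d \<gamma> where "d > 0" "\<gamma> 0 = \<one>" "left_invariant_curve c w {-d<..<d} \<gamma>"
    "\<And>t. t \<in> {-d<..<d} \<Longrightarrow> \<gamma> t \<in> fst c" "smooth_on {-d<..<d}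
        (\<lambda>t. snd c (\<gamma> t))"
proof -
  note cc = chart[OF c(1)]
  let ?W = "snd c ` fst c" and ?e = "snd c \<one>"
  let ?O = "snd (prod_chart c c) ` (fst (prod_chart c c) \<inter> (\<lambda>(x, y). x \<otimes> y)
      -` fst c)"
  define m where "m = snd c \<circ> (\<lambda>(x, y). x \<otimes> y) \<circ> chart_inv (prod_chart c c)"
  have m: "smooth_on ?O m"
    unfolding m_def using smooth_mult_chart(2)[OF c(1) c(1) c(1)] .
  \<comment> \<open>The left-invariant field in coordinates: the derivative of multiplication in its
    second argument, at the unit, in the direction \<open>w\<close>. The direction
    \<open>(0, w)\<close> is fixed, so smoothness of \<open>F\<close> follows from that of
    \<open>m\<close> restricted to an affine slice.\<close>
  define F where "F x = frechet_derivative m (at (x, ?e)) (0, w)" for x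
  have inO: "(snd c x, ?e) \<in> ?O" if "x \<in> fst c" for x
  proof (rule image_eqI)
    show "(snd c x, ?e) = snd (prod_chart c c) (x, \<one>)" by (simp add: prod_chart_simps)
    show "(x, \<one>) \<in> fst (prod_chart c c) \<inter> (\<lambda>(x, y). x \<otimes> y) -` fst c"
      using that c chart_carrier[OF c(1) that] by (simp add: prod_chart_simps)
  qed
  have F: "smooth_on ?W F"
  proof -
    have Dm: "smooth_on ?O (\<lambda>z. frechet_derivative m (at z) (0, w))"
      unfolding smooth_on_def
    proof
      fix k
      have "k_smooth_on (Suc k) ?O m" using m unfolding smooth_on_def by blast
      then show "k_smooth_on k ?O (\<lambda>z. frechet_derivative m (at z) (0, w))" by (rule
          k_smooth_on_derivative)
    qed
    have "smooth_on ?W (\<lambda>x. frechet_derivative m (at ((0, ?e) + (x, 0))) (0, w))"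
    proof (rule smooth_on_affine_compose[OF Dm is_chart_open_image[OF cc]])
      show "bounded_linear (\<lambda>x. (x, 0))" by (intro bounded_linear_intros)
      show "(0, ?e) + (x, 0) \<in> ?O" if "x \<in> ?W" for x
        using that inO by auto
    qed
    then show ?thesis by (simp add: F_def[abs_def])
  qed
  obtain d y where d: "d > 0" and y0: "y 0 = ?e" and yW: "\<And>t. t \<in> {-d<..<d}
      \<Longrightarrow> y t \<in> ?W"
    and yD: "\<And>t. t \<in> {-d<..<d} \<Longrightarrow> (y has_vector_derivative F (y t)) (at t)"
    and ys: "smooth_on {-d<..<d} y"
    by (rule smooth_ode_solution[OF is_chart_open_image[OF cc] imageI[OF c(2)] F]) blast
  let ?J = "{-d<..<d}"
  define \<gamma> where "\<gamma> t = chart_inv c (y t)" for t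
  have \<gamma>0: "\<gamma> 0 = \<one>" by (simp add: \<gamma>_def y0 chart_inv_left[OF cc c(2)])
  have \<gamma>c: "\<gamma> t \<in> fst c" and c\<gamma>: "snd c (\<gamma> t) = y t" if "t \<in> ?J"
      for t
    using yW[OF that] by (simp_all add: \<gamma>_def chart_inv_into chart_inv_right)
  have \<gamma>cont: "continuous_map (top_of_set ?J) (mtop (mfd G)) \<gamma>"
  proof -
    have "continuous_on ?J y"
      using yD by (intro continuous_at_imp_continuous_on ballI has_vector_derivative_continuous)
    then have "continuous_map (top_of_set ?J) (top_of_set ?W) y" using yW by auto
    from continuous_map_compose[OF this continuous_map_chart_inv[OF cc]]
    show ?thesis by (simp add: \<gamma>_def[abs_def] o_def)
  qed
  have D: "((\<lambda>s. snd c (inv (\<gamma> t) \<otimes> \<gamma> s)) has_vector_derivative w) (at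
      t)" if t: "t \<in> ?J" for t
  proof -
    let ?g = "\<gamma> t"
    have g: "?g \<in> carrier G" using chart_carrier[OF c(1) \<gamma>c[OF t]] .
    note L = smooth_left_translation[OF inv_closed[OF g]]
    \<comment> \<open>The velocity at \<open>t\<close> of the left translate by the inverse of
      \<open>?g\<close> of any curve that passes through \<open>?g\<close> with coordinate velocity
      \<open>F (y t)\<close>. Its value is determined below by a comparison curve.\<close>
    let ?D = "frechet_derivative (snd c \<circ> (\<lambda>x. inv ?g \<otimes> x) \<circ> chart_inv
        c) (at (y t)) (F (y t))"
    have leftD: "((\<lambda>s. snd c (inv ?g \<otimes> \<sigma> s)) has_vector_derivative ?D) (at t)"
      if "\<sigma> t = ?g" "eventually (\<lambda>s. \<sigma> s \<in> fst c) (nhds t)"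
        "((\<lambda>s. snd c (\<sigma> s)) has_vector_derivative F (y t)) (at t)" for \<sigma>
      using smooth_map_curve_derivative[OF L c(1) c(1), where \<sigma> = \<sigma> and t = t, OF _
          chart_inv_left[OF cc] that(2,3)]
      by (simp add: that(1) g c c\<gamma>[OF t])
    have "((\<lambda>s. snd c (\<gamma> s)) has_vector_derivative F (y t)) (at t)"
      by (rule has_vector_derivative_transform_within_open[OF yD[OF t] open_greaterThanLessThan t])
          (simp add: c\<gamma>)
    then have 1: "((\<lambda>s. snd c (inv ?g \<otimes> \<gamma> s)) has_vector_derivative ?D) (at t)"
      by (intro leftD refl continuous_curve_eventually[OF open_greaterThanLessThan \<gamma>cont c(1)
          t \<gamma>c[OF t]])
    \<comment> \<open>\<open>\<gamma>\<close> and \<open>s \<mapsto> \<gamma> t \<otimes> \<tau> s\<close> have the same velocity at \<open>t\<close>, hence so have their left translates by \<open>inv (\<gamma> t)\<close>.\<close>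
    define \<tau> where "\<tau> s = chart_inv c (?e + (s - t) *\<^sub>R w)" for s
    have lineD: "((\<lambda>s. ?e + (s - t) *\<^sub>R w) has_vector_derivative w) (at t)"
      by (auto intro!: derivative_eq_intros)
    define I where "I = (\<lambda>s. ?e + (s - t) *\<^sub>R w) -` ?W"
    have I: "open I" "t \<in> I"
      unfolding I_def using is_chart_open_image[OF cc] c(2)
      by (auto intro!: open_vimage continuous_intros)
    have \<tau>I: "\<tau> s \<in> fst c" "snd c (\<tau> s) = ?e + (s - t) *\<^sub>R w" if "s \<in>
        I" for s
      using that by (simp_all add: I_def \<tau>_def chart_inv_into chart_inv_right)
    have \<tau>t: "\<tau> t = \<one>" by (simp add: \<tau>_def chart_inv_left[OF cc c(2)])
    have \<tau>D: "((\<lambda>s. snd c (\<tau> s)) has_vector_derivative w) (at t)"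
      by (rule has_vector_derivative_transform_within_open[OF lineD I]) (simp add: \<tau>I)
    have gD: "((\<lambda>s. snd c ((\<lambda>(x, y). x \<otimes> y) (?g, \<tau> s)))
        has_vector_derivative
      frechet_derivative (snd c \<circ> (\<lambda>(x, y). x \<otimes> y) \<circ> chart_inv
          (prod_chart c c))
        (at (snd (prod_chart c c) (?g, \<tau> t))) (0, w)) (at t)"
    proof (rule smooth_map_curve_derivative[OF smooth_mult prod_chart_in_atlas[OF c(1) c(1)] c(1),
        where \<sigma> = "\<lambda>s. (?g, \<tau> s)"])
      show "(\<lambda>(x, y). x \<otimes> y) (?g, \<tau> t) \<in> fst c" by (simp add: \<tau>t g
          \<gamma>c[OF t])
      show "chart_inv (prod_chart c c) (snd (prod_chart c c) x) = x" if "x \<in> fst (prod_chart c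
          c)" for x
        using that by (rule prod_chart_inv_left[OF cc cc])
    next
      show "eventually (\<lambda>s. (?g, \<tau> s) \<in> fst (prod_chart c c)) (nhds t)"
        using eventually_nhds_in_open[OF I]
        by (rule eventually_mono) (simp add: prod_chart_simps \<gamma>c[OF t] \<tau>I)
      show "((\<lambda>s. snd (prod_chart c c) (?g, \<tau> s)) has_vector_derivative (0, w)) (at t)"
        using has_vector_derivative_Pair[OF has_vector_derivative_const \<tau>D] by (simp add:
            prod_chart_simps)
    qed
    have \<sigma>D: "((\<lambda>s. snd c (?g \<otimes> \<tau> s)) has_vector_derivative F (y t)) (at t)"
      using gD by (simp add: F_def m_def prod_chart_simps \<tau>t c\<gamma>[OF t])
    let ?I = "{s \<in> I. ?g \<otimes> \<tau> s \<in> fst c}"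
    have opI: "open ?I"
    proof (rule continuous_curve_open[OF I(1) _ c(1)], rule continuous_map_mult_const[OF g])
      have "continuous_map (top_of_set I) (top_of_set ?W) (\<lambda>s. ?e + (s - t) *\<^sub>R w)"
        by (auto simp: I_def intro!: continuous_intros)
      from continuous_map_compose[OF this continuous_map_chart_inv[OF cc]]
      show "continuous_map (top_of_set I) (mtop (mfd G)) \<tau>" by (simp add: \<tau>_def[abs_def] o_def)
    qed
    have tI: "t \<in> ?I" using I(2) by (simp add: \<tau>t g \<gamma>c[OF t])
    have 2: "((\<lambda>s. snd c (inv ?g \<otimes> (?g \<otimes> \<tau> s))) has_vector_derivative
        ?D) (at t)"
    proof (rule leftD[OF _ _ \<sigma>D])
      show "?g \<otimes> \<tau> t = ?g" by (simp add: \<tau>t g)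
      show "\<forall>\<^sub>F s in nhds t. ?g \<otimes> \<tau> s \<in> fst c"
        using eventually_nhds_in_open[OF opI tI] by (rule eventually_mono) simp
    qed
    \<comment> \<open>Undoing the translation returns \<open>\<tau>\<close> itself, a straight
      coordinate line of velocity \<open>w\<close>; uniqueness of derivatives gives
      \<open>?D = w\<close>.\<close>
    have "((\<lambda>s. snd c (\<tau> s)) has_vector_derivative ?D) (at t)"
      by (rule has_vector_derivative_transform_within_open[OF 2 I])
        (simp add: mult_inv_cancel g chart_carrier[OF c(1) \<tau>I(1)])
    from vector_derivative_unique_at[OF this \<tau>D] 1 show ?thesis by simp
  qed
  show thesis
  proof (rule that[where \<gamma> = \<gamma> and d = d, OF d \<gamma>0 _ \<gamma>c])
    show "left_invariant_curve c w ?J \<gamma>" using D \<gamma>cont by (simp add: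
        left_invariant_curve_def)
    show "smooth_on ?J (\<lambda>t. snd c (\<gamma> t))"
      by (rule smooth_on_cong[OF open_greaterThanLessThan _ ys]) (simp add: c\<gamma>)
  qed
qed

end

context Lie_group
begin

lemma one_parameter_subgroup_props:
  assumes "one_parameter_subgroup G \<Gamma>"
  shows "continuous_map euclidean (mtop (mfd G)) \<Gamma>" "\<Gamma> (s + t) = \<Gamma> s \<otimes>
      \<Gamma> t" "\<Gamma> t \<in> carrier G"
    "\<Gamma> 0 = \<one>" "\<Gamma> (- t) = inv (\<Gamma> t)"
proof -
  show cont: "continuous_map euclidean (mtop (mfd G)) \<Gamma>"
    using assms smooth_map_from_model_iff one_parameter_subgroup_def by metis
  show hom: "\<Gamma> (s + t) = \<Gamma> s \<otimes> \<Gamma> t" for s t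
    using assms by (simp add: one_parameter_subgroup_def)
  show car: "\<Gamma> t \<in> carrier G" for t
    using continuous_map_image_subset_topspace[OF cont] points_eq by auto
  have "\<Gamma> 0 \<otimes> \<Gamma> 0 = \<Gamma> 0" using hom[of 0 0] by simp
  then show one: "\<Gamma> 0 = \<one>" using car[of 0] by simp
  have "\<Gamma> (- t) \<otimes> \<Gamma> t = \<one>" using hom[of "- t" t] one by simp
  then show "\<Gamma> (- t) = inv (\<Gamma> t)" using inv_equality car by metis
qed

text \<open>The quotient of the values at \<open>t\<close> and \<open>s\<close> is the value at
  \<open>s - t\<close>, so its velocity at \<open>s = t\<close> is the velocity at 0.\<close>

lemma one_parameter_subgroup_left_invariant:
  assumes G: "one_parameter_subgroup G \<Gamma>" and D: "((\<lambda>t. snd c (\<Gamma> t))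
      has_vector_derivative w) (at 0)"
  shows "left_invariant_curve c w UNIV \<Gamma>"
  unfolding left_invariant_curve_def
proof (intro conjI ballI)
  note props = one_parameter_subgroup_props[OF G]
  show "continuous_map (top_of_set UNIV) (mtop (mfd G)) \<Gamma>" using props(1) by simp
  fix t :: real
  have "inv (\<Gamma> t) \<otimes> \<Gamma> s = \<Gamma> (s - t)" for s
    using props(2)[of "- t" s] props(5)[of t] by simp
  moreover have "((\<lambda>s. snd c (\<Gamma> (s - t))) has_vector_derivative w) (at t)"
  proof -
    have "((\<lambda>s. s - t) has_vector_derivative 1) (at t)" by (auto intro!: derivative_eq_intros)
    moreover have "((\<lambda>t. snd c (\<Gamma> t)) has_vector_derivative w) (at (t - t))" using D
        by simp
    ultimately show ?thesis using vector_diff_chain_at by (fastforce simp: o_def)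
  qed
  ultimately show "((\<lambda>s. snd c (inv (\<Gamma> t) \<otimes> \<Gamma> s))
      has_vector_derivative w) (at t)" by simp
qed

lemma one_parameter_subgroup_unique:
  assumes c: "c \<in> atlas (mfd G)" "\<one> \<in> fst c"
    and "one_parameter_subgroup G \<alpha>" "((\<lambda>t. snd c (\<alpha> t)) has_vector_derivative
        w) (at 0)"
    and "one_parameter_subgroup G \<beta>" "((\<lambda>t. snd c (\<beta> t)) has_vector_derivative
        w) (at 0)"
  shows "\<alpha> = \<beta>"
proof
  fix t
  show "\<alpha> t = \<beta> t"
    by (rule left_invariant_curve_unique[OF c open_UNIV connected_UNIV
          one_parameter_subgroup_left_invariant[OF assms(3,4)]
          one_parameter_subgroup_left_invariant[OF assms(5,6)] UNIV_I[of 0]])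
      (simp_all add: one_parameter_subgroup_props(4)[OF assms(3)] one_parameter_subgroup_props(4)[OF
          assms(5)])
qed

lemma one_parameter_subgroup_exists:
  assumes c: "c \<in> atlas (mfd G)" "\<one> \<in> fst c"
  obtains \<Gamma> where "one_parameter_subgroup G \<Gamma>" "((\<lambda>t. snd c (\<Gamma> t))
      has_vector_derivative w) (at 0)"
proof -
  obtain d \<gamma> where d: "d > 0" and \<gamma>0: "\<gamma> 0 = \<one>" and \<gamma>:
      "left_invariant_curve c w {-d<..<d} \<gamma>"
    and \<gamma>c: "\<And>t. t \<in> {-d<..<d} \<Longrightarrow> \<gamma> t \<in> fst c" and
        \<gamma>s: "smooth_on {-d<..<d} (\<lambda>t. snd c (\<gamma> t))"
    by (rule left_invariant_curve_exists[OF c]) blast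
  let ?J = "{-d<..<d}"
  have \<gamma>cont: "continuous_map (top_of_set ?J) (mtop (mfd G)) \<gamma>"
    using \<gamma> by (simp add: left_invariant_curve_def)
  have J: "t \<in> ?J \<longleftrightarrow> \<bar>t\<bar> < d" for t by auto
  have car: "\<gamma> t \<in> carrier G" if "\<bar>t\<bar> < d" for t
    using continuous_curve_carrier[OF \<gamma>cont] that J by blast
  have hom: "\<gamma> (s + t) = \<gamma> s \<otimes> \<gamma> t" if s: "\<bar>s\<bar> < d" and t:
      "\<bar>t\<bar> < d" and st: "\<bar>s + t\<bar> < d" for s t
  proof -
    \<comment> \<open>The times at which both the shifted and the translated curve are defined. As
      an intersection of two intervals this set is connected, and it contains 0, where the curves
      agree, and \<open>t\<close>.\<close>
    let ?I = "?J \<inter> {r. s + r \<in> ?J}"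
    have I: "?I = ?J \<inter> {-d - s<..<d - s}" by auto
    have op: "open ?I" and con: "connected ?I"
      unfolding I by (auto intro!: convex_connected convex_Int)
    have 1: "left_invariant_curve c w ?I (\<lambda>r. \<gamma> (s + r))"
      by (rule left_invariant_curve_subset[OF left_invariant_curve_shift[OF \<gamma>]]) blast
    have 2: "left_invariant_curve c w ?I (\<lambda>r. \<gamma> s \<otimes> \<gamma> r)"
      by (rule left_invariant_curve_subset[OF left_invariant_curve_translate[OF car[OF s]
          \<gamma>]]) auto
    show ?thesis
    proof (rule left_invariant_curve_unique[OF c op con 1 2, of 0 t])
      show "0 \<in> ?I" "t \<in> ?I" using s t st d by auto
      show "\<gamma> (s + 0) = \<gamma> s \<otimes> \<gamma> 0" using car[OF s] by (simp add: \<gamma>0)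
    qed
  qed
  obtain \<Gamma> where \<Gamma>car: "\<And>t. \<Gamma> t \<in> carrier G" and \<Gamma>hom: "\<And>s
      t. \<Gamma> (s + t) = \<Gamma> s \<otimes> \<Gamma> t"
    and \<Gamma>\<gamma>: "\<And>t. \<bar>t\<bar> < d \<Longrightarrow> \<Gamma> t = \<gamma> t"
    by (rule local_hom_extends[of d \<gamma>, OF d car hom]) blast+
  \<comment> \<open>Near any time \<open>r\<close> the extension is a left translate of the local
    solution. Continuity and smoothness therefore pass from an interval around 0 to the whole
    line.\<close>
  have near: "\<Gamma> t = \<Gamma> r \<otimes> \<gamma> (t - r)" if "t - r \<in> ?J" for t r
    using \<Gamma>hom[of r "t - r"] \<Gamma>\<gamma>[of "t - r"] that J by simp
  have near_open: "open {t. t - r \<in> ?J \<and> \<Gamma> r \<otimes> \<gamma> (t - r) \<in> V}"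
    if V: "openin (mtop (mfd G)) V" for r V
  proof -
    have "openin (top_of_set ?J) {u \<in> ?J. \<Gamma> r \<otimes> \<gamma> u \<in> V}"
      using openin_continuous_map_preimage[OF continuous_map_mult_const[OF \<Gamma>car \<gamma>cont]
          V] by simp
    then have "open {u \<in> ?J. \<Gamma> r \<otimes> \<gamma> u \<in> V}" by (simp only:
        openin_open_eq[OF open_greaterThanLessThan])
    then have "open ((\<lambda>t. t - r) -` {u \<in> ?J. \<Gamma> r \<otimes> \<gamma> u \<in> V})"
      by (rule open_vimage) (intro continuous_intros)
    then show ?thesis by (simp add: vimage_def)
  qed
  have self: "\<Gamma> r \<otimes> \<gamma> (r - r) = \<Gamma> r" "r - r \<in> ?J" for r using
      \<Gamma>car d by (simp_all add: \<gamma>0)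
  have cont: "continuous_map euclidean (mtop (mfd G)) \<Gamma>"
    unfolding continuous_map_def
  proof (intro conjI allI impI)
    show "\<Gamma> \<in> topspace euclidean \<rightarrow> points (mfd G)" using \<Gamma>car by (simp
        add: points_eq)
    fix V assume V: "openin (mtop (mfd G)) V"
    have "open {t. \<Gamma> t \<in> V}"
    proof (rule openI)
      fix r assume r: "r \<in> {t. \<Gamma> t \<in> V}"
      have "r \<in> {t. t - r \<in> ?J \<and> \<Gamma> r \<otimes> \<gamma> (t - r) \<in> V}" using
          r self[of r] by simp
      from openE[OF near_open[OF V] this]
      obtain e where "e > 0" "ball r e \<subseteq> {t. t - r \<in> ?J \<and> \<Gamma> r \<otimes>
          \<gamma> (t - r) \<in> V}" .
      moreover have "{t. t - r \<in> ?J \<and> \<Gamma> r \<otimes> \<gamma> (t - r) \<in> V}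
          \<subseteq> {t. \<Gamma> t \<in> V}"
      proof
        fix t assume "t \<in> {t. t - r \<in> ?J \<and> \<Gamma> r \<otimes> \<gamma> (t - r) \<in> V}"
        then have "t - r \<in> ?J" "\<Gamma> r \<otimes> \<gamma> (t - r) \<in> V" by blast+
        then show "t \<in> {t. \<Gamma> t \<in> V}" by (simp only: near[of t r] mem_Collect_eq)
      qed
      ultimately show "\<exists>T>0. ball r T \<subseteq> {t. \<Gamma> t \<in> V}" by blast
    qed
    then show "openin euclidean {x \<in> topspace euclidean. \<Gamma> x \<in> V}" by simp
  qed
  have smooth: "smooth_on (\<Gamma> -` fst e) (\<lambda>t. snd e (\<Gamma> t))" if e: "e \<in> atlas
      (mfd G)" for e
  proof (rule smooth_on_local)
    fix r assume r: "r \<in> \<Gamma> -` fst e"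
    let ?T = "{t. t - r \<in> ?J \<and> \<Gamma> r \<otimes> \<gamma> (t - r) \<in> fst e}"
    have T: "open ?T" by (rule near_open[OF is_chart_openin[OF chart[OF e]]])
    have "smooth_on ?T (\<lambda>t. snd c (\<gamma> (- r + t)))"
      by (rule smooth_on_affine_compose[OF \<gamma>s T bounded_linear_ident]) simp
    then have "smooth_on ?T (\<lambda>t. (snd e \<circ> (\<lambda>x. \<Gamma> r \<otimes> x) \<circ>
        chart_inv c) (snd c (\<gamma> (- r + t))))"
    proof (rule smooth_on_compose[OF T _ smooth_map_chart[OF smooth_left_translation[OF \<Gamma>car]
        c(1) e]])
      show "(\<lambda>t. snd c (\<gamma> (- r + t))) ` ?T \<subseteq> snd c ` (fst c \<inter>
          (\<lambda>x. \<Gamma> r \<otimes> x) -` fst e)"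
      proof (rule image_subsetI, rule imageI)
        fix t assume "t \<in> ?T"
        then show "\<gamma> (- r + t) \<in> fst c \<inter> (\<lambda>x. \<Gamma> r \<otimes> x) -`
            fst e" using \<gamma>c[of "t - r"] by simp
      qed
    qed
    then have "smooth_on ?T (\<lambda>t. snd e (\<Gamma> t))"
    proof (rule smooth_on_cong[OF T, rotated])
      fix t assume "t \<in> ?T"
      then show "(snd e \<circ> (\<lambda>x. \<Gamma> r \<otimes> x) \<circ> chart_inv c) (snd c
          (\<gamma> (- r + t))) = snd e (\<Gamma> t)"
        using near[of t r] \<gamma>c[of "t - r"] by (simp add: chart_inv_left[OF chart[OF c(1)]])
    qed
    moreover have "r \<in> ?T" using r self[of r] by simp
    ultimately show "\<exists>T. open T \<and> r \<in> T \<and> smooth_on T (\<lambda>t. snd e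
        (\<Gamma> t))" using T by blast
  qed
  have "one_parameter_subgroup G \<Gamma>"
    using cont smooth \<Gamma>hom by (simp add: one_parameter_subgroup_def smooth_map_from_model_iff)
  moreover have "((\<lambda>t. snd c (\<Gamma> t)) has_vector_derivative w) (at 0)"
  proof -
    have 0: "0 \<in> ?J" using d by simp
    then have "((\<lambda>s. snd c (inv (\<gamma> 0) \<otimes> \<gamma> s)) has_vector_derivative w)
        (at 0)"
      using \<gamma> unfolding left_invariant_curve_def by blast
    then show ?thesis
      by (rule has_vector_derivative_transform_within_open[OF _ open_greaterThanLessThan 0])
        (simp add: \<gamma>0 \<Gamma>\<gamma> car abs_less_iff minus_less_iff)
  qed
  ultimately show thesis by (rule that)
qed

section \<open>Velocity at the unit and the exponential map under scaling and conjugation\<close>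

lemma charts_at_one: "c \<in> charts_at (mfd G) \<one> \<longleftrightarrow> c \<in> atlas (mfd G)
    \<and> \<one> \<in> fst c"
  by (simp add: charts_at_def)

lemma ex_chart_at_one: "\<exists>c. c \<in> charts_at (mfd G) \<one>"
  using obtain_chart[OF one_closed] charts_at_one by metis

text \<open>Presents a change of charts as a smooth map, so that the chain rule for curves yields
  the transformation law of velocities.\<close>

lemma smooth_map_id: "smooth_map (mfd G) (mfd G) (\<lambda>x. x)"
proof -
  have "smooth_on (snd c ` (fst c \<inter> (\<lambda>x. x) -` fst d)) (snd d \<circ> (\<lambda>x. x)
      \<circ> chart_inv c)"
    if "c \<in> atlas (mfd G)" "d \<in> atlas (mfd G)" for c d
    using manifold that unfolding smooth_manifold_def by (simp add: o_def)
  then show ?thesis by (simp add: smooth_map_def)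
qed

text \<open>A tangent vector is determined by its coordinates in one chart: velocities transform by
  the derivative of the change of charts, as tangent vectors do by definition, and both sides are 0
  on pairs that are not charts at the unit.\<close>

lemma velocity_eqI:
  assumes v: "v \<in> lie_algebra G" and c: "c \<in> charts_at (mfd G) \<one>"
    and \<gamma>: "one_parameter_subgroup G \<gamma>"
    and D: "((\<lambda>t. snd c (\<gamma> t)) has_vector_derivative v c) (at 0)"
  shows "velocity (mfd G) \<gamma> 0 = v"
proof
  fix d
  note props = one_parameter_subgroup_props[OF \<gamma>]
  have c': "c \<in> atlas (mfd G)" "\<one> \<in> fst c" using c charts_at_one by auto
  show "velocity (mfd G) \<gamma> 0 d = v d"
  proof (cases "d \<in> charts_at (mfd G) \<one>")
    case True
    then have d: "d \<in> atlas (mfd G)" "\<one> \<in> fst d" using charts_at_one by auto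
    have "((\<lambda>s. snd d (\<gamma> s)) has_vector_derivative
      frechet_derivative (snd d \<circ> (\<lambda>x. x) \<circ> chart_inv c) (at (snd c (\<gamma>
          0))) (v c)) (at 0)"
    proof (rule smooth_map_curve_derivative[OF smooth_map_id c'(1) d(1) _ chart_inv_left[OF chart[OF
        c'(1)]] _ D])
      show "\<gamma> 0 \<in> fst d" by (simp add: props(4) d)
      show "\<forall>\<^sub>F s in nhds 0. \<gamma> s \<in> fst c"
        by (rule continuous_curve_eventually[OF open_UNIV _ c'(1)]) (simp_all add: props(1,4) c')
    qed
    moreover have "frechet_derivative (snd d \<circ> (\<lambda>x. x) \<circ> chart_inv c) (at (snd c
        (\<gamma> 0))) (v c) = v d"
    proof -
      have "v d = frechet_derivative (snd d \<circ> chart_inv c) (at (snd c \<one>)) (v c)"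
        using v c True unfolding lie_algebra_def tangent_space_def by blast
      then show ?thesis by (simp only: props(4) o_def)
    qed
    ultimately show ?thesis
      using True by (simp add: velocity_def props(4) o_def vector_derivative_at)
  next
    case False
    then have "v d = 0" using v unfolding lie_algebra_def tangent_space_def by blast
    then show ?thesis using False by (simp add: velocity_def props(4))
  qed
qed

text \<open>\<open>velocity\<close> is built from \<open>vector_derivative\<close>, which is
  informative only where a derivative exists; smoothness of the subgroup supplies it.\<close>

lemma velocity_has_vector_derivative:
  assumes \<gamma>: "one_parameter_subgroup G \<gamma>" and c: "c \<in> charts_at (mfd G) \<one>"
  shows "((\<lambda>t. snd c (\<gamma> t)) has_vector_derivative velocity (mfd G) \<gamma> 0 c) (at 0)"
proof -
  note props = one_parameter_subgroup_props[OF \<gamma>]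
  have c': "c \<in> atlas (mfd G)" "\<one> \<in> fst c" using c charts_at_one by auto
  have "smooth_on (\<gamma> -` fst c) (\<lambda>t. snd c (\<gamma> t))"
    using \<gamma> c' by (simp add: one_parameter_subgroup_def smooth_map_from_model_iff)
  then have "k_smooth_on (Suc 0) (\<gamma> -` fst c) (\<lambda>t. snd c (\<gamma> t))" unfolding
      smooth_on_def by blast
  then have "(\<lambda>t. snd c (\<gamma> t)) differentiable (at 0)" using c' by (simp add: props(4))
  then have "((\<lambda>t. snd c (\<gamma> t)) has_vector_derivative vector_derivative (\<lambda>t.
      snd c (\<gamma> t)) (at 0)) (at 0)"
    by (simp add: vector_derivative_works)
  then show ?thesis using c by (simp add: velocity_def props(4) o_def)
qed

lemma one_parameter_subgroup_velocity_unique: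
  assumes "one_parameter_subgroup G \<alpha>" "one_parameter_subgroup G \<beta>"
    and "velocity (mfd G) \<alpha> 0 = velocity (mfd G) \<beta> 0"
  shows "\<alpha> = \<beta>"
proof -
  obtain c where c: "c \<in> charts_at (mfd G) \<one>" using ex_chart_at_one by blast
  then have c': "c \<in> atlas (mfd G)" "\<one> \<in> fst c" using charts_at_one by auto
  show ?thesis
    using one_parameter_subgroup_unique[OF c' assms(1) velocity_has_vector_derivative[OF assms(1) c]
        assms(2)]
      velocity_has_vector_derivative[OF assms(2) c] assms(3) by simp
qed

lemma lie_exp_eqI:
  assumes "one_parameter_subgroup G \<gamma>" "velocity (mfd G) \<gamma> 0 = v"
  shows "lie_exp G v = \<gamma> 1"
proof -
  have "(THE \<gamma>. one_parameter_subgroup G \<gamma> \<and> velocity (mfd G) \<gamma> 0 = v) =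
      \<gamma>"
    using assms one_parameter_subgroup_velocity_unique by (intro the_equality) auto
  then show ?thesis by (simp add: lie_exp_def)
qed

lemma one_parameter_subgroup_of_velocity:
  assumes v: "v \<in> lie_algebra G"
  obtains \<gamma> where "one_parameter_subgroup G \<gamma>" "velocity (mfd G) \<gamma> 0 = v"
proof -
  obtain c where c: "c \<in> charts_at (mfd G) \<one>" using ex_chart_at_one by blast
  then have c': "c \<in> atlas (mfd G)" "\<one> \<in> fst c" using charts_at_one by auto
  obtain \<gamma> where "one_parameter_subgroup G \<gamma>" "((\<lambda>t. snd c (\<gamma> t))
      has_vector_derivative v c) (at 0)"
    by (rule one_parameter_subgroup_exists[OF c'])
  with velocity_eqI[OF v c] that show thesis by blast
qed

text \<open>The rescaled curve \<open>s \<mapsto> \<gamma> (t * s)\<close> is a one-parameter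
  subgroup with velocity \<open>t\<close> times \<open>v\<close>, and its value at 1 is
  \<open>\<gamma> t\<close>. This recovers the whole subgroup from a function defined by values at
  1.\<close>

lemma lie_exp_tscale:
  assumes \<gamma>: "one_parameter_subgroup G \<gamma>" and v: "velocity (mfd G) \<gamma> 0 = v"
  shows "lie_exp G (tscale t v) = \<gamma> t"
proof -
  note props = one_parameter_subgroup_props[OF \<gamma>]
  let ?\<delta> = "\<lambda>s. \<gamma> (t * s)"
  have op: "open (?\<delta> -` fst d)" if d: "d \<in> atlas (mfd G)" for d
  proof -
    have "open {s \<in> UNIV. \<gamma> s \<in> fst d}"
      by (rule continuous_curve_open[OF open_UNIV _ d]) (simp add: props(1))
    then have "open ((\<lambda>s. t * s) -` {s \<in> UNIV. \<gamma> s \<in> fst d})"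
      by (rule open_vimage) (intro continuous_intros)
    then show ?thesis by (simp add: vimage_def)
  qed
  have "one_parameter_subgroup G ?\<delta>"
    unfolding one_parameter_subgroup_def smooth_map_from_model_iff
  proof (intro conjI ballI allI)
    have "continuous_map euclidean euclidean (\<lambda>s. t * s)" by (simp add: continuous_intros)
    from continuous_map_compose[OF this props(1)]
    show "continuous_map euclidean (mtop (mfd G)) ?\<delta>" by (simp add: o_def)
    show "?\<delta> (r + s) = ?\<delta> r \<otimes> ?\<delta> s" for r s using props(2) by (simp
        add: distrib_left)
    fix d assume d: "d \<in> atlas (mfd G)"
    have "smooth_on (\<gamma> -` fst d) (\<lambda>t. snd d (\<gamma> t))"
      using \<gamma> d by (simp add: one_parameter_subgroup_def smooth_map_from_model_iff)
    from smooth_on_affine_compose[OF this op[OF d] bounded_linear_mult_right[of t], of 0]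
    show "smooth_on (?\<delta> -` fst d) (\<lambda>s. snd d (?\<delta> s))" by simp
  qed
  moreover have "velocity (mfd G) ?\<delta> 0 = tscale t v"
  proof
    fix d
    show "velocity (mfd G) ?\<delta> 0 d = tscale t v d"
    proof (cases "d \<in> charts_at (mfd G) \<one>")
      case True
      have 1: "((\<lambda>s. t * s) has_vector_derivative t) (at 0)" by (auto intro!:
          derivative_eq_intros)
      have "((\<lambda>s. snd d (\<gamma> s)) has_vector_derivative v d) (at (t * 0))"
        using velocity_has_vector_derivative[OF \<gamma> True] by (simp add: v)
      from vector_diff_chain_at[OF 1 this]
      show ?thesis using True by (simp add: velocity_def props(4) tscale_def o_def vector_derivative_at)
    next
      case False
      then have "v d = 0" unfolding v[symmetric] by (simp add: velocity_def props(4))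
      then show ?thesis using False by (simp add: velocity_def props(4) tscale_def)
    qed
  qed
  ultimately show ?thesis using lie_exp_eqI[of ?\<delta> "tscale t v"] by simp
qed

text \<open>Conjugating a one-parameter subgroup gives another, and the chain rule identifies its
  velocity at 0 with the image of \<open>v\<close> under \<open>Ad\<close>; scaling then applies to
  both subgroups.\<close>

lemma lie_exp_Ad:
  assumes v: "v \<in> lie_algebra G" and g: "g \<in> carrier G"
  shows "lie_exp G (tscale t (Ad G g v)) = g \<otimes> lie_exp G (tscale t v) \<otimes> inv g"
proof -
  obtain \<gamma> where \<gamma>: "one_parameter_subgroup G \<gamma>" and v\<gamma>: "velocity (mfd
      G) \<gamma> 0 = v"
    by (rule one_parameter_subgroup_of_velocity[OF v])
  note props = one_parameter_subgroup_props[OF \<gamma>]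
  let ?C = "\<lambda>x. g \<otimes> x \<otimes> inv g"
  have C: "smooth_map (mfd G) (mfd G) ?C" by (rule smooth_two_sided_translation[OF g inv_closed[OF g]])
  let ?\<delta> = "\<lambda>s. ?C (\<gamma> s)"
  have \<delta>: "one_parameter_subgroup G ?\<delta>"
    unfolding one_parameter_subgroup_def
  proof (intro conjI allI)
    have "smooth_map model_manifold (mfd G) \<gamma>" using \<gamma> by (simp add:
        one_parameter_subgroup_def)
    from smooth_map_compose[OF is_chart_model manifold chart this C]
    show "smooth_map model_manifold (mfd G) ?\<delta>" by (simp add: o_def)
    show "?\<delta> (r + s) = ?\<delta> r \<otimes> ?\<delta> s" for r s
      using g by (simp add: props(2,3) m_assoc mult_inv_cancel)
  qed
  have "velocity (mfd G) ?\<delta> 0 = Ad G g v"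
  proof
    fix d
    \<comment> \<open>The very chart that \<open>tangent_map\<close> selects, so that the derivative
      from the chain rule and the one inside \<open>Ad\<close> coincide literally.\<close>
    define c where "c = (SOME c. c \<in> charts_at (mfd G) \<one>)"
    have c: "c \<in> charts_at (mfd G) \<one>" unfolding c_def by (rule someI_ex[OF ex_chart_at_one])
    then have c': "c \<in> atlas (mfd G)" "\<one> \<in> fst c" using charts_at_one by auto
    have C1: "?C \<one> = \<one>" using g by simp
    show "velocity (mfd G) ?\<delta> 0 d = Ad G g v d"
    proof (cases "d \<in> charts_at (mfd G) \<one>")
      case True
      then have d: "d \<in> atlas (mfd G)" "\<one> \<in> fst d" using charts_at_one by auto
      have "((\<lambda>s. snd d (?\<delta> s)) has_vector_derivative
        frechet_derivative (snd d \<circ> ?C \<circ> chart_inv c) (at (snd c (\<gamma> 0))) (v c))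
            (at 0)"
      proof (rule smooth_map_curve_derivative[OF C c'(1) d(1) _ chart_inv_left[OF chart[OF c'(1)]]])
        show "?C (\<gamma> 0) \<in> fst d" using C1 d by (simp add: props(4))
        show "\<forall>\<^sub>F s in nhds 0. \<gamma> s \<in> fst c"
          by (rule continuous_curve_eventually[OF open_UNIV _ c'(1)]) (simp_all add: props(1,4) c')
        show "((\<lambda>s. snd c (\<gamma> s)) has_vector_derivative v c) (at 0)"
          using velocity_has_vector_derivative[OF \<gamma> c] by (simp add: v\<gamma>)
      qed
      then have "vector_derivative (\<lambda>s. snd d (?\<delta> s)) (at 0) = frechet_derivative
          (snd d \<circ> ?C \<circ> chart_inv c) (at (snd c \<one>)) (v c)"
        by (simp add: vector_derivative_at props(4))
      then show ?thesis using True C1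
        by (simp add: velocity_def props(4) Ad_def tangent_map_def c_def[symmetric] o_def)
    next
      case False
      then show ?thesis using C1 by (simp add: velocity_def props(4) Ad_def tangent_map_def)
    qed
  qed
  from lie_exp_tscale[OF \<delta> this, of t] lie_exp_tscale[OF \<gamma> v\<gamma>, of t] show
      ?thesis by simp
qed

lemma lie_exp_tscale_props:
  assumes v: "v \<in> lie_algebra G"
  shows "lie_exp G (tscale t v) \<in> carrier G"
    "lie_exp G (tscale (s + t) v) = lie_exp G (tscale s v) \<otimes> lie_exp G (tscale t v)"
    "lie_exp G (tscale 0 v) = \<one>"
    "lie_exp G (tscale (- t) v) = inv (lie_exp G (tscale t v))"
proof -
  obtain \<gamma> where \<gamma>: "one_parameter_subgroup G \<gamma>" and v\<gamma>: "velocity (mfd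
      G) \<gamma> 0 = v"
    by (rule one_parameter_subgroup_of_velocity[OF v])
  note props = one_parameter_subgroup_props[OF \<gamma>]
  show "lie_exp G (tscale t v) \<in> carrier G"
    "lie_exp G (tscale (s + t) v) = lie_exp G (tscale s v) \<otimes> lie_exp G (tscale t v)"
    "lie_exp G (tscale 0 v) = \<one>"
    "lie_exp G (tscale (- t) v) = inv (lie_exp G (tscale t v))"
    unfolding lie_exp_tscale[OF \<gamma> v\<gamma>] using props by simp_all
qed

end

section \<open>The gauge quandle\<close>

text \<open>Closure is contained in the continuity of the action map, since a continuous map sends
  the underlying set of its source into that of its target.\<close>

lemma smooth_right_action_closed:
  assumes "lie_group G" "smooth_right_action G P act" "p \<in> points P" "g \<in> carrier G"
  shows "act p g \<in> points P"
proof -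
  have "continuous_map (prod_topology (mtop P) (mtop (mfd G))) (mtop P) (\<lambda>(p, g). act p g)"
    using assms(2) smooth_map_continuous unfolding smooth_right_action_def
    by (fastforce simp: product_manifold_def)
  from continuous_map_image_subset_topspace[OF this]
  have "(\<lambda>(p, g). act p g) (p, g) \<in> points P" using assms by (auto simp: lie_group_def)
  then show ?thesis by simp
qed

text \<open>In a local trivialization the action is right multiplication on the group component,
  where a fixed element forces the unit by cancellation.\<close>

lemma principal_bundle_free:
  assumes B: "principal_bundle G P M \<pi> act" and p: "p \<in> points P" and g: "g \<in> carrier G"
    and eq: "act p g = p"
  shows "g = \<one>\<^bsub>G\<^esub>"
proof -
  interpret Lie_group G
    using B by (simp add: principal_bundle_def Lie_group_def Lie_group_axioms_def lie_group_def)
  have "continuous_map (mtop P) (mtop M) \<pi>"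
    using B smooth_map_continuous unfolding principal_bundle_def by blast
  from continuous_map_image_subset_topspace[OF this] p have "\<pi> p \<in> points M" by blast
  then obtain U \<Phi> where U: "\<pi> p \<in> U" and triv: "local_trivialization G P M \<pi> act U
      \<Phi>"
    using B unfolding principal_bundle_def by blast
  have "bij_betw \<Phi> (points (open_submanifold P {p \<in> points P. \<pi> p \<in> U}))
      (points (product_manifold (open_submanifold M U) (mfd G)))"
    using triv by (simp add: local_trivialization_def diffeomorphism_def)
  moreover have "p \<in> points (open_submanifold P {p \<in> points P. \<pi> p \<in> U})"
    using p U by (simp add: open_submanifold_def)
  ultimately have "\<Phi> p \<in> points (product_manifold (open_submanifold M U) (mfd G))"
    by (rule bij_betw_apply)
  then have h: "snd (\<Phi> p) \<in> carrier G" by (auto simp: product_manifold_def points_eq)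
  have "\<Phi> (act p g) = (fst (\<Phi> p), snd (\<Phi> p) \<otimes>\<^bsub>G\<^esub> g)"
    using triv p U g unfolding local_trivialization_def by blast
  then have "snd (\<Phi> p) \<otimes>\<^bsub>G\<^esub> g = snd (\<Phi> p)" using eq by (metis snd_conv)
  then show ?thesis using h g by simp
qed

theorem theorem13:
  fixes G :: "('g, 'e::euclidean_model) lie_grp"
    and P :: "('p, 'f::euclidean_model) manifold"
    and M :: "('m, 'h::euclidean_model) manifold"
    and \<pi> :: "'p \<Rightarrow> 'm"
    and act :: "'p \<Rightarrow> 'g \<Rightarrow> 'p"
    and X :: "'p \<Rightarrow> ('g, 'e) tangent"
  assumes "lie_group G"
    and "smooth_manifold M"
    and "principal_bundle G P M \<pi> act"
    and "adjoint_section G P act X"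
  shows "lie_quandle P (gauge_op G act X) \<and> noether_quandle P (gauge_op G act X)"
proof -
  interpret Lie_group G
    using assms(1) by (simp add: Lie_group_def Lie_group_axioms_def lie_group_def)
  have P: "smooth_manifold P" and action: "smooth_right_action G P act"
    using assms(3) by (simp_all add: principal_bundle_def)
  note closed = smooth_right_action_closed[OF assms(1) action]
  have act_one: "act p \<one>\<^bsub>G\<^esub> = p" if "p \<in> points P" for p
    using action that by (simp add: smooth_right_action_def)
  have act_act: "act (act p g) h = act p (g \<otimes>\<^bsub>G\<^esub> h)" if "p \<in> points P" "g
      \<in> carrier G" "h \<in> carrier G" for p g h
    using action that by (simp add: smooth_right_action_def)
  have X: "X p \<in> lie_algebra G" if "p \<in> points P" for p
    using assms(4) that by (simp add: adjoint_section_def smooth_into_lie_algebra_def)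
  have X_act: "X (act p g) = Ad G (inv\<^bsub>G\<^esub> g) (X p)" if "p \<in> points P" "g \<in>
      carrier G" for p g
    using assms(4) that by (simp add: adjoint_section_def)
  define E where "E p t = lie_exp G (tscale t (X p))" for p t
  note E_props = lie_exp_tscale_props[OF X, folded E_def]
  note E_closed = E_props(1) and E_add = E_props(2) and E_zero = E_props(3) and E_minus = E_props(4)
  have E_act: "E (act p g) t = inv\<^bsub>G\<^esub> g \<otimes>\<^bsub>G\<^esub> (E p t
      \<otimes>\<^bsub>G\<^esub> g)" if "p \<in> points P" "g \<in> carrier G" for p g t
    using lie_exp_Ad[OF X[OF that(1)], of "inv\<^bsub>G\<^esub> g" t] that E_closed[OF that(1)]
    by (simp add: E_def X_act m_assoc)
  have E_commute: "E p s \<otimes>\<^bsub>G\<^esub> E p t = E p t \<otimes>\<^bsub>G\<^esub> E p s"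
      if "p \<in> points P" for p s t
    using E_add[OF that, of s t] E_add[OF that, of t s] by (simp add: add.commute)
  have op: "gauge_op G act X x t y = act x (inv\<^bsub>G\<^esub> (E x t) \<otimes>\<^bsub>G\<^esub>
      E y t)" if "x \<in> points P" for x t y
    using E_minus[OF that, of t] by (simp add: gauge_op_def E_def)
  have op_closed: "gauge_op G act X x t y \<in> points P" if "x \<in> points P" "y \<in> points P"
      for x y t
    using that by (simp add: op closed E_closed)
  \<comment> \<open>Acting on \<open>x\<close> by \<open>y\<close> conjugates the subgroup of
    \<open>x\<close> by \<open>E y t\<close> alone: the other half of the gauge transformation,
    \<open>E x t\<close>, commutes with \<open>E x s\<close> and drops out. All quandle axioms
    reduce to this formula.\<close>
  have E_op: "E (gauge_op G act X x t y) s = inv\<^bsub>G\<^esub> (E y t) \<otimes>\<^bsub>G\<^esub>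
      (E x s \<otimes>\<^bsub>G\<^esub> E y t)"
    if x: "x \<in> points P" and y: "y \<in> points P" for x y s t
  proof -
    note car = E_closed[OF x] E_closed[OF y]
    have "E (gauge_op G act X x t y) s = inv\<^bsub>G\<^esub> (E y t) \<otimes>\<^bsub>G\<^esub> (E
        x t \<otimes>\<^bsub>G\<^esub> (E x s \<otimes>\<^bsub>G\<^esub> (inv\<^bsub>G\<^esub> (E x
        t) \<otimes>\<^bsub>G\<^esub> E y t)))"
      using x car by (simp add: op E_act inv_mult_group m_assoc)
    also have "E x t \<otimes>\<^bsub>G\<^esub> (E x s \<otimes>\<^bsub>G\<^esub>
        (inv\<^bsub>G\<^esub> (E x t) \<otimes>\<^bsub>G\<^esub> E y t)) = (E x t
        \<otimes>\<^bsub>G\<^esub> E x s) \<otimes>\<^bsub>G\<^esub> (inv\<^bsub>G\<^esub> (E x t)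
        \<otimes>\<^bsub>G\<^esub> E y t)"
      using car by (simp add: m_assoc)
    also have "\<dots> = E x s \<otimes>\<^bsub>G\<^esub> E y t"
      unfolding E_commute[OF x, of t s] using car by (simp add: m_assoc mult_inv_cancel)
    finally show ?thesis .
  qed
  have self_action: "gauge_op G act X (gauge_op G act X x t y) s y = gauge_op G act X x (s + t) y"
    if x: "x \<in> points P" and y: "y \<in> points P" for x y s t
  proof -
    note car = E_closed[OF x] E_closed[OF y]
    have "gauge_op G act X (gauge_op G act X x t y) s y
      = act (act x (inv\<^bsub>G\<^esub> (E x t) \<otimes>\<^bsub>G\<^esub> E y t))
          (inv\<^bsub>G\<^esub> (inv\<^bsub>G\<^esub> (E y t) \<otimes>\<^bsub>G\<^esub> (E x s
          \<otimes>\<^bsub>G\<^esub> E y t)) \<otimes>\<^bsub>G\<^esub> E y s)"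
      using op_closed[OF x y] by (simp add: op[OF x] op E_op[OF x y, unfolded op[OF x]])
    also have "\<dots> = act x (inv\<^bsub>G\<^esub> (E x t) \<otimes>\<^bsub>G\<^esub>
        (inv\<^bsub>G\<^esub> (E x s) \<otimes>\<^bsub>G\<^esub> (E y t \<otimes>\<^bsub>G\<^esub> E
        y s)))"
      using x car by (simp add: act_act inv_mult_group m_assoc mult_inv_cancel)
    \<comment> \<open>Inverting \<open>E x (s + t)\<close> reverses its two factors, as required on
      the left; on the right the factors of \<open>E y\<close> stand in the opposite order and are
      exchanged by commutativity.\<close>
    also have "\<dots> = act x (inv\<^bsub>G\<^esub> (E x (s + t)) \<otimes>\<^bsub>G\<^esub> E y (s
        + t))"
      unfolding E_add[OF x, of s t] E_add[OF y, of s t] E_commute[OF y, of t s]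
      using car by (simp add: inv_mult_group m_assoc)
    finally show ?thesis by (simp add: op[OF x])
  qed
  \<comment> \<open>Both sides act on \<open>x\<close> by the inverse of \<open>E x s\<close> times
    \<open>E x t\<close>, followed by \<open>E y t\<close> and \<open>E z s\<close>. They differ
    only in the order of the two factors belonging to \<open>x\<close>, which commute.\<close>
  have self_distributive: "gauge_op G act X (gauge_op G act X x t y) s z
      = gauge_op G act X (gauge_op G act X x s z) t (gauge_op G act X y s z)"
    if x: "x \<in> points P" and y: "y \<in> points P" and z: "z \<in> points P" for x y z s t
  proof -
    note car = E_closed[OF x] E_closed[OF y] E_closed[OF z]
    have "gauge_op G act X (gauge_op G act X x t y) s z
      = act (act x (inv\<^bsub>G\<^esub> (E x t) \<otimes>\<^bsub>G\<^esub> E y t))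
          (inv\<^bsub>G\<^esub> (inv\<^bsub>G\<^esub> (E y t) \<otimes>\<^bsub>G\<^esub> (E x s
          \<otimes>\<^bsub>G\<^esub> E y t)) \<otimes>\<^bsub>G\<^esub> E z s)"
      unfolding op[OF op_closed[OF x y]] E_op[OF x y] unfolding op[OF x] ..
    also have "\<dots> = act x (inv\<^bsub>G\<^esub> (E x s \<otimes>\<^bsub>G\<^esub> E x t)
        \<otimes>\<^bsub>G\<^esub> (E y t \<otimes>\<^bsub>G\<^esub> E z s))"
      using x car by (simp add: act_act inv_mult_group m_assoc mult_inv_cancel)
    also have "\<dots> = act x (inv\<^bsub>G\<^esub> (E x t \<otimes>\<^bsub>G\<^esub> E x s)
        \<otimes>\<^bsub>G\<^esub> (E y t \<otimes>\<^bsub>G\<^esub> E z s))"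
      unfolding E_commute[OF x, of s t] ..
    \<comment> \<open>Read from right to left: expanding the conjugates by \<open>E z s\<close>
      makes all inner occurrences of \<open>E z s\<close> and its inverse cancel in pairs.\<close>
    also have "\<dots> = act (act x (inv\<^bsub>G\<^esub> (E x s) \<otimes>\<^bsub>G\<^esub> E z s))
        (inv\<^bsub>G\<^esub> (inv\<^bsub>G\<^esub> (E z s) \<otimes>\<^bsub>G\<^esub> (E x t
            \<otimes>\<^bsub>G\<^esub> E z s)) \<otimes>\<^bsub>G\<^esub> (inv\<^bsub>G\<^esub> (E z
            s) \<otimes>\<^bsub>G\<^esub> (E y t \<otimes>\<^bsub>G\<^esub> E z s)))"
      using x car by (simp add: act_act inv_mult_group m_assoc mult_inv_cancel)
    also have "\<dots> = gauge_op G act X (gauge_op G act X x s z) t (gauge_op G act X y s z)"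
      unfolding op[OF op_closed[OF x z]] E_op[OF x z] E_op[OF y z] unfolding op[OF x] ..
    finally show ?thesis .
  qed
  have idempotent: "gauge_op G act X x s x = x" if x: "x \<in> points P" for x s
    using x E_closed[OF x] by (simp add: op act_one)
  have fixed_iff: "gauge_op G act X x t y = x \<longleftrightarrow> E x t = E y t"
    if x: "x \<in> points P" and y: "y \<in> points P" for x y t
  proof
    note car = E_closed[OF x] E_closed[OF y]
    assume "gauge_op G act X x t y = x"
    then have "inv\<^bsub>G\<^esub> (E x t) \<otimes>\<^bsub>G\<^esub> E y t = \<one>\<^bsub>G\<^esub>"
      using principal_bundle_free[OF assms(3) x] car by (simp add: op[OF x])
    then show "E x t = E y t" using mult_inv_cancel(1)[OF car, of t t] car by simp
  next
    assume "E x t = E y t"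
    then show "gauge_op G act X x t y = x" using x E_closed[OF y] by (simp add: op act_one)
  qed
  have "lie_quandle P (gauge_op G act X)"
    unfolding lie_quandle_def
    using P op_closed self_action self_distributive idempotent by blast
  moreover from this have "noether_quandle P (gauge_op G act X)"
    unfolding noether_quandle_def using fixed_iff by metis
  ultimately show ?thesis by blast
qed

end
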